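(* For every integer $M\ge2$, the bit energy at zero spectral efficiency and the wideband slope achieved by $M$-ary PSK signaling over the AWGN channel with hard-decision detection (defined in the context) are $$\left.\frac{E_b}{N_0}\right|_{\mathsf{C}=0} = \begin{cases}\dfrac{\pi}{2}\log_e 2 & M=2,\\[4pt] \dfrac{4\pi}{M^2\sin^2\frac{\pi}{M}}\log_e2 & M\ge3,\end{cases}$$ and $$S_0=\begin{cases}\dfrac{3}{\pi-1} & M=2,\\[4pt] 0 & M=3,\\[4pt] \dfrac{6}{\pi-1} & M=4,\\[4pt] \dfrac{\frac{M^4}{8\pi^2}\sin^4\frac{\pi}{M}}{-\psi(M)} & M\ge5,\end{cases}$$ respectively, where $$\psi(M) = \frac{M^2}{16\pi^2}\left((2-\pi)\sin^2\frac{2\pi}{M} + (M^2-4\pi)\sin^4\frac{\pi}{M} - 2M\sin^2\frac{\pi}{M}\sin\frac{2\pi}{M}\right).$$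
   Context: AWGN channel with $M$-ary PSK and hard decisions: the input is $x\in\{0,\dots,M-1\}$; when $x=m$ the transmitted signal is $s_m=\sqrt{\mathcal{E}}\,e^{j2\pi m/M}$, $\mathcal{E}\ge 0$, and the received signal is $r=s_m+n$, where $n$ is a zero-mean circularly symmetric complex Gaussian random variable with $E\{|n|^2\}=N_0>0$. Set $\mathrm{SNR}=\mathcal{E}/N_0$. The maximum likelihood detector outputs $y=l\in\{0,\dots,M-1\}$ when $r$ lies in the sector $D_l=\{|r|e^{j\theta}: (2l-1)\pi/M\le\theta<(2l+1)\pi/M\}$ (angles modulo $2\pi$). Let $P_{l,0}=P(y=l\mid x=0)$. The capacity in nats per symbol (natural logarithm) is $C_M(\mathrm{SNR})=\log M+\sum_{l=0}^{M-1}P_{l,0}\log P_{l,0}$, $\mathrm{SNR}\ge0$. Let $\dot C_M(0)$, $\ddot C_M(0)$ be its first and second right derivatives with respect to $\mathrm{SNR}$ at $\mathrm{SNR}=0$ (in nats), the latter possibly being $+\infty$. The normalized energy per bit is $E_b/N_0=\mathrm{SNR}/C(\mathrm{SNR})$ with $C$ the capacity in bits per symbol, and the spectral efficiency $\mathsf{C}(E_b/N_0)$ is $C(\mathrm{SNR})$ in bits/s/Hz. The bit energy required at zero spectral efficiency (the limit of $E_b/N_0$ as $\mathrm{SNR}\to0$) is $\left.\frac{E_b}{N_0}\right|_{\mathsf{C}=0}=\frac{\log_e2}{\dot C_M(0)}$, and the wideband slope is $S_0=\frac{2(\dot C_M(0))^2}{-\ddot C_M(0)}$, with $S_0=0$ when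 $\ddot C_M(0)=\infty$. *)

theory Defs
  imports "HOL-Probability.Probability"
begin

definition psk_signal :: "nat \<Rightarrow> real \<Rightarrow> nat \<Rightarrow> complex" where
  "psk_signal M En m = of_real (sqrt En) * cis (2 * pi * real m / real M)"

text \<open>Zero-mean circularly symmetric complex Gaussian law with \<open>E |n|\<^sup>2 = N0\<close>: the real and
  imaginary parts are independent, each normal with mean 0 and variance \<open>N0 / 2\<close>.
  The second argument of \<^const>\<open>normal_density\<close> is the standard deviation.\<close>

definition complex_noise :: "real \<Rightarrow> complex measure" where
  "complex_noise N0 =
     distr (density lborel (\<lambda>x. ennreal (normal_density 0 (sqrt (N0 / 2)) x)) \<Otimes>\<^sub>M
            density lborel (\<lambda>x. ennreal (normal_density 0 (sqrt (N0 / 2)) x)))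
       borel (\<lambda>(x, y). Complex x y)"

text \<open>The sectors overlap only in the origin, a null event.\<close>

definition decision_region :: "nat \<Rightarrow> nat \<Rightarrow> complex set" where
  "decision_region M l =
     {of_real \<rho> * cis \<theta> | \<rho> \<theta>.
        0 \<le> \<rho> \<and> (2 * real l - 1) * pi / real M \<le> \<theta> \<and> \<theta> < (2 * real l + 1) * pi / real M}"

definition psk_prob :: "nat \<Rightarrow> real \<Rightarrow> real \<Rightarrow> nat \<Rightarrow> nat \<Rightarrow> real" where
  "psk_prob M N0 En l m =
     measure (complex_noise N0) {n. psk_signal M En m + n \<in> decision_region M l}"

text \<open>Capacity in nats per symbol as a function of the SNR; the noise level \<open>N0\<close> is held fixed
  and the symbol energy is \<open>snr * N0\<close>.\<close>

definition capacity :: "nat \<Rightarrow> real \<Rightarrow> real \<Rightarrow> real" where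
  "capacity M N0 snr =
     ln (real M) + (\<Sum>l<M. psk_prob M N0 (snr * N0) l 0 * ln (psk_prob M N0 (snr * N0) l 0))"

definition capacity_bits :: "nat \<Rightarrow> real \<Rightarrow> real \<Rightarrow> real" where
  "capacity_bits M N0 snr = capacity M N0 snr / ln 2"

definition bit_energy :: "nat \<Rightarrow> real \<Rightarrow> real \<Rightarrow> real" where
  "bit_energy M N0 snr = snr / capacity_bits M N0 snr"

text \<open>Derivative on the domain \<open>[0, \<infinity>)\<close>: one-sided (right) at 0, two-sided elsewhere.\<close>

definition capacity_deriv :: "nat \<Rightarrow> real \<Rightarrow> real \<Rightarrow> real" where
  "capacity_deriv M N0 snr = vector_derivative (capacity M N0) (at snr within {0..})"

text \<open>Second right derivative at 0, as an extended real so that the value \<open>\<infinity>\<close> is allowed.\<close>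

definition capacity_deriv2_quot :: "nat \<Rightarrow> real \<Rightarrow> real \<Rightarrow> ereal" where
  "capacity_deriv2_quot M N0 snr = ereal ((capacity_deriv M N0 snr - capacity_deriv M N0 0) / snr)"

definition capacity_deriv2_zero :: "nat \<Rightarrow> real \<Rightarrow> ereal" where
  "capacity_deriv2_zero M N0 = Lim (at_right 0) (capacity_deriv2_quot M N0)"

definition bit_energy_zero :: "nat \<Rightarrow> real \<Rightarrow> real" where
  "bit_energy_zero M N0 = ln 2 / capacity_deriv M N0 0"

definition wideband_slope :: "nat \<Rightarrow> real \<Rightarrow> real" where
  "wideband_slope M N0 =
     (if capacity_deriv2_zero M N0 = \<infinity> then 0
      else 2 * (capacity_deriv M N0 0)\<^sup>2 / (- real_of_ereal (capacity_deriv2_zero M N0)))"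

definition psk_psi :: "nat \<Rightarrow> real" where
  "psk_psi M = (real M)\<^sup>2 / (16 * pi\<^sup>2) *
     ((2 - pi) * (sin (2 * pi / real M))\<^sup>2
      + ((real M)\<^sup>2 - 4 * pi) * sin (pi / real M) ^ 4
      - 2 * real M * (sin (pi / real M))\<^sup>2 * sin (2 * pi / real M))"

end

theory Submission
  imports Defs "HOL-Real_Asymp.Real_Asymp" "HOL-Library.Real_Mod"
begin

text \<open>
  With \<open>t = \<surd>SNR\<close>, the derivative in \<open>t\<close> of the probability of a sector is the flux of the Gaussian
  density through its two edges, and each flux is an elementary expression in the Gaussian tail
  function. Hence the sector probabilities are smooth in \<open>t\<close>, and with \<open>P\<^sub>l(0) = 1/M\<close> the derivative
  of the negative entropy can be expanded as \<open>A t + B t\<^sup>2 + C t\<^sup>3 + o(t\<^sup>3)\<close>. In terms of the SNR this reads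
  \<open>A/2 + (B/2) \<surd>SNR + (C/2) SNR + o(SNR)\<close> for the derivative of the capacity, so the second derivative at
  0 is \<open>C/2\<close>, unless \<open>B > 0\<close>, when it is infinite. The coefficients are trigonometric sums over the
  \<open>M\<close>-th roots of unity; \<open>B\<close> only contains cubic sums and vanishes unless \<open>M = 3\<close>, while the quartic
  sums in \<open>C\<close> behave differently for \<open>M = 2\<close> and \<open>M = 4\<close>.
\<close>

text \<open>A shift of the signal along the real axis changes the probability of a sector only
  through its edges. On the ray of direction \<phi> the normal component of a unit shift is
  \<open>sin \<phi>\<close>, and the point at radius r has squared distance
  \<open>(t * sin \<phi>)\<^sup>2 + (r - t * cos \<phi>)\<^sup>2\<close> from the signal;
  integrating the density over r \<ge> 0 gives \<open>ray_flux\<close>. Nothing is differentiated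
  under an integral sign: a substitution moves all dependence on t into the lower limit of a tail
  integral.

  The derivative of the entropy is expanded, rather than the entropy itself, because the second
  derivative is a limit of difference quotients of the first, and an expansion cannot be
  differentiated term by term. The order t^3 is what this requires: \<open>sqrt\<close> contributes
  the divisor \<open>2 * sqrt snr\<close>, one power of t, and the difference quotient contributes
  two more. Every edge is shared by two sectors, so the fluxes sum to zero; this turns
  \<open>ln P\<close> into \<open>ln (M * P)\<close>, which vanishes at t = 0.\<close>

section \<open>Expansion of the summands of the entropy derivative\<close>

text \<open>L'Hopital against a power: an asymptotic order known for the derivative is raised by one
  for the function. Repeated use replaces a Taylor theorem.\<close>

lemma tendsto_antideriv_over_power:
  fixes h k :: "real \<Rightarrow> real"
  assumes "\<And>t. t > 0 \<Longrightarrow> (h has_real_derivative k t) (at t)"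
    and "(h \<longlongrightarrow> 0) (at_right 0)"
    and "((\<lambda>t. k t / t ^ n) \<longlongrightarrow> L) (at_right 0)"
  shows "((\<lambda>t. h t / t ^ Suc n) \<longlongrightarrow> L / Suc n) (at_right 0)"
proof (rule lhopital_right_0)
  show "eventually (\<lambda>t. (h has_real_derivative k t) (at t)) (at_right 0)"
    using assms(1) by (auto simp: eventually_at_right_field intro: exI[of _ 1])
  show "eventually (\<lambda>t::real. ((\<lambda>t. t ^ Suc n) has_real_derivative real (Suc n) * t ^ n) (at t)) (at_right 0)"
    using DERIV_pow[of "Suc n"] by (intro always_eventually) simp
  show "((\<lambda>t::real. t ^ Suc n) \<longlongrightarrow> 0) (at_right 0)"
    by (rule tendsto_eq_intros refl | simp)+
  show "\<forall>\<^sub>F t::real in at_right 0. t ^ Suc n \<noteq> 0" "\<forall>\<^sub>F t::real in at_right 0. real (Suc n) * t ^ n \<noteq> 0"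
    by (rule eventually_at_rightI[of 0 1]; simp)+
  have "((\<lambda>t. k t / t ^ n / Suc n) \<longlongrightarrow> L / Suc n) (at_right 0)"
    by (intro tendsto_intros assms) auto
  then show "((\<lambda>t. k t / (real (Suc n) * t ^ n)) \<longlongrightarrow> L / real (Suc n)) (at_right 0)"
    by (simp add: mult.commute)
qed (use assms(2) in auto)

text \<open>The numbers a, b, c are the Taylor coefficients of q, hence a, 2 b, 3 c are those of f.
  The result is the product of the series of f with that of \<open>ln (1 + u)\<close> for
  \<open>u = m * q t - 1\<close>, cut after t^3. A derivative of f1 at the single point 0 is enough
  for this order.\<close>

lemma mult_ln_expansion:
  fixes q f f1 :: "real \<Rightarrow> real"
  assumes q: "\<And>t. (q has_real_derivative f t) (at t)"
    and f: "\<And>t. (f has_real_derivative f1 t) (at t)"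
    and f1: "(f1 has_real_derivative 6 * c) (at 0)"
    and q0: "q 0 = 1 / m" and f0: "f 0 = a" and f10: "f1 0 = 2 * b" and m: "m > 0"
  shows "((\<lambda>t. (f t * ln (m * q t) - m * a\<^sup>2 * t - (3 * m * a * b - m\<^sup>2 * a ^ 3 / 2) * t\<^sup>2) / t ^ 3)
    \<longlongrightarrow> 4 * m * a * c + 2 * m * b\<^sup>2 - 2 * m\<^sup>2 * a\<^sup>2 * b + m ^ 3 * a ^ 4 / 3) (at_right 0)"
proof -
  define q3 where "q3 t = (q t - 1 / m - a * t - b * t\<^sup>2) / t ^ 3" for t
  define f3 where "f3 t = (f t - a - 2 * b * t) / t ^ 2" for t
  \<comment> \<open>The value at 0 is the limit of the quotient: L is evaluated at
    \<open>t * v t\<close>, which may vanish for positive t, so a limit along nonzero arguments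
    would not suffice.\<close>
  define L :: "real \<Rightarrow> real" where "L u = (if u = 0 then 1/3 else (ln (1 + u) - u + u\<^sup>2/2) / u ^ 3)" for u
  define v where "v t = m * (a + b * t + t ^ 2 * q3 t)" for t
  have cont: "(q \<longlongrightarrow> q 0) (at_right 0)" "(f \<longlongrightarrow> f 0) (at_right 0)"
    using q[of 0] f[of 0] DERIV_isCont continuous_within_subset[of _ UNIV]
    by (auto simp: isCont_def intro: tendsto_mono[OF at_le])
  have "((\<lambda>t. (f1 t - 2 * b) / t) \<longlongrightarrow> 6 * c) (at_right 0)"
    using f1 f10 unfolding has_field_derivative_iff by (auto intro: tendsto_mono[OF at_le])
  then have "((\<lambda>t. (f t - a - 2 * b * t) / t ^ Suc 1) \<longlongrightarrow> 6 * c / Suc 1) (at_right 0)"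
    by (intro tendsto_antideriv_over_power[where k = "\<lambda>t. f1 t - 2 * b"])
       (auto intro!: derivative_eq_intros f tendsto_eq_intros cont simp: f0)
  then have f3: "(f3 \<longlongrightarrow> 3 * c) (at_right 0)"
    unfolding f3_def by (simp add: power2_eq_square)
  then have "((\<lambda>t. (q t - 1 / m - a * t - b * t\<^sup>2) / t ^ Suc 2) \<longlongrightarrow> 3 * c / Suc 2) (at_right 0)"
    unfolding f3_def
    by (intro tendsto_antideriv_over_power[where k = "\<lambda>t. f t - a - 2 * b * t"])
       (auto intro!: derivative_eq_intros q tendsto_eq_intros cont simp: q0)
  then have q3: "(q3 \<longlongrightarrow> c) (at_right 0)"
    unfolding q3_def by (simp add: numeral_3_eq_3)
  have "((\<lambda>u::real. (ln (1 + u) - u + u\<^sup>2/2) / u ^ 3) \<longlongrightarrow> 1/3) (at 0)"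
    by real_asymp
  then have "(L \<longlongrightarrow> 1/3) (at 0)"
    by (rule Lim_transform_eventually) (auto simp: L_def eventually_at_filter)
  moreover have L0: "L 0 = 1/3" by (simp add: L_def)
  ultimately have "isCont L 0" unfolding isCont_def by metis
  moreover have v: "(v \<longlongrightarrow> m * a) (at_right 0)"
    unfolding v_def by (rule tendsto_eq_intros q3 refl | simp)+
  then have "((\<lambda>t. t * v t) \<longlongrightarrow> 0) (at_right 0)"
    using tendsto_mult[OF tendsto_ident_at v] by simp
  ultimately have Lt: "((\<lambda>t. L (t * v t)) \<longlongrightarrow> 1/3) (at_right 0)"
    using isCont_tendsto_compose[of 0 L] L0 by metis
  \<comment> \<open>The quotient in the claim, with the division by t^3 carried out exactly. The
    logarithm has t-coefficient m a and t^2-coefficient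
    \<open>m * b - m\<^sup>2 * a\<^sup>2 / 2\<close>; the long bracket is its remainder over t^3.
    All ingredients now converge.\<close>
  have "((\<lambda>t. (a + 2 * b * t + t\<^sup>2 * f3 t) * (m * q3 t - m\<^sup>2 * (2 * a * b + t * (b\<^sup>2 + 2 * a * q3 t + 2 * b * t * q3 t + t\<^sup>2 * (q3 t)\<^sup>2)) / 2
      + v t ^ 3 * L (t * v t)) + (2 * b + t * f3 t) * (m * b - m\<^sup>2 * a\<^sup>2 / 2) + f3 t * m * a)
    \<longlongrightarrow> a * (m * c - m\<^sup>2 * (2 * a * b) / 2 + (m * a) ^ 3 * (1/3)) + 2 * b * (m * b - m\<^sup>2 * a\<^sup>2 / 2) + 3 * c * m * a) (at_right 0)"
    by (rule tendsto_eq_intros f3 q3 v Lt refl | simp)+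
  also have "a * (m * c - m\<^sup>2 * (2 * a * b) / 2 + (m * a) ^ 3 * (1/3)) + 2 * b * (m * b - m\<^sup>2 * a\<^sup>2 / 2) + 3 * c * m * a
     = 4 * m * a * c + 2 * m * b\<^sup>2 - 2 * m\<^sup>2 * a\<^sup>2 * b + m ^ 3 * a ^ 4 / 3"
    by (simp add: algebra_simps power2_eq_square power3_eq_cube power4_eq_xxxx)
  finally show ?thesis
  proof (rule Lim_transform_eventually)
    have "(f t * ln (m * q t) - m * a\<^sup>2 * t - (3 * m * a * b - m\<^sup>2 * a ^ 3 / 2) * t\<^sup>2) / t ^ 3 =
      (a + 2 * b * t + t\<^sup>2 * f3 t) * (m * q3 t - m\<^sup>2 * (2 * a * b + t * (b\<^sup>2 + 2 * a * q3 t + 2 * b * t * q3 t + t\<^sup>2 * (q3 t)\<^sup>2)) / 2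
      + v t ^ 3 * L (t * v t)) + (2 * b + t * f3 t) * (m * b - m\<^sup>2 * a\<^sup>2 / 2) + f3 t * m * a" if "t > 0" for t
    proof -
      have 1: "f t = a + 2 * b * t + t\<^sup>2 * f3 t" using that by (simp add: f3_def)
      have 2: "m * q t = 1 + t * v t"
        using that m by (simp add: v_def q3_def power2_eq_square power3_eq_cube field_simps)
      have "ln (1 + u) = u - u\<^sup>2 / 2 + u ^ 3 * L u" for u by (simp add: L_def)
      then have 3: "ln (m * q t) = t * v t - (t * v t)\<^sup>2 / 2 + (t * v t) ^ 3 * L (t * v t)"
        unfolding 2 .
      have "f t * ln (m * q t) - m * a\<^sup>2 * t - (3 * m * a * b - m\<^sup>2 * a ^ 3 / 2) * t\<^sup>2 =
       t ^ 3 * ((a + 2 * b * t + t\<^sup>2 * f3 t) * (m * q3 t - m\<^sup>2 * (2 * a * b + t * (b\<^sup>2 + 2 * a * q3 t + 2 * b * t * q3 t + t\<^sup>2 * (q3 t)\<^sup>2)) / 2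
      + v t ^ 3 * L (t * v t)) + (2 * b + t * f3 t) * (m * b - m\<^sup>2 * a\<^sup>2 / 2) + f3 t * m * a)"
        unfolding 3 1 by (simp add: v_def field_simps) algebra
      then show ?thesis using that by (simp add: field_simps)
    qed
    then show "\<forall>\<^sub>F t in at_right 0. (a + 2 * b * t + t\<^sup>2 * f3 t) * (m * q3 t - m\<^sup>2 * (2 * a * b + t * (b\<^sup>2 + 2 * a * q3 t + 2 * b * t * q3 t + t\<^sup>2 * (q3 t)\<^sup>2)) / 2
      + v t ^ 3 * L (t * v t)) + (2 * b + t * f3 t) * (m * b - m\<^sup>2 * a\<^sup>2 / 2) + f3 t * m * a =
      (f t * ln (m * q t) - m * a\<^sup>2 * t - (3 * m * a * b - m\<^sup>2 * a ^ 3 / 2) * t\<^sup>2) / t ^ 3"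
      by (auto simp: eventually_at_right_field intro: exI[of _ 1])
  qed
qed

section \<open>Trigonometric sums\<close>

text \<open>Real part of the geometric sum of powers of an M-th root of unity w, where w = 1 exactly
  when M divides k.\<close>

lemma sum_cos_multiples:
  assumes "0 < M"
  shows "(\<Sum>l<M. cos (real k * (2 * pi * real l / real M))) = (if M dvd k then real M else 0)"
proof -
  define w where "w = cis (2 * pi * real k / real M)"
  have "real M * (2 * pi * real k / real M) = 2 * pi * real k"
    using assms by simp
  then have "w ^ M = cis (2 * pi * real k)"
    unfolding w_def by (metis Complex.DeMoivre)
  then have "w ^ M = 1"
    by (simp add: cis_multiple_2pi)
  moreover have "w = 1 \<longleftrightarrow> M dvd k"
  proof
    assume "w = 1"
    then obtain n :: int where "2 * pi * real k / real M = of_int n * (2 * pi)"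
      by (auto simp: w_def cis_eq_1_iff)
    then have "real_of_int (int k) = real_of_int (n * int M)"
      using assms by (simp add: field_simps)
    then have "int k = n * int M" by (simp only: of_int_eq_iff)
    then have "int M dvd int k" by simp
    then show "M dvd k" by simp
  next
    assume "M dvd k"
    then obtain j where "k = M * j" by auto
    then show "w = 1"
      using assms cis_multiple_2pi[of "real j"] by (simp add: w_def mult.assoc)
  qed
  ultimately have "(\<Sum>l<M. w ^ l) = (if M dvd k then of_nat M else 0)"
    by (simp add: sum_gp_strict)
  then have "Re (\<Sum>l<M. w ^ l) = (if M dvd k then real M else 0)"
    by simp
  also have "Re (\<Sum>l<M. w ^ l) = (\<Sum>l<M. cos (real k * (2 * pi * real l / real M)))"
    by (auto simp: w_def Complex.DeMoivre Re_sum intro!: sum.cong arg_cong[of _ _ cos])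
  finally show ?thesis .
qed

lemma sin_3: "sin (3 * x) = 3 * sin x - 4 * sin x ^ 3" for x :: real
proof -
  have "sin (3 * x) = sin (2 * x + x)" by simp
  also have "\<dots> = 2 * sin x * (cos x)\<^sup>2 + (1 - 2 * (sin x)\<^sup>2) * sin x"
    by (simp only: sin_add sin_double cos_double_sin) (simp add: power2_eq_square)
  also have "\<dots> = 3 * sin x - 4 * sin x ^ 3"
    unfolding cos_squared_eq by algebra
  finally show ?thesis .
qed

text \<open>Here x is the direction of a sector's axis and d its half-angle. The second derivative
  of the flux at 0 involves the cube of the sine of the edge angle, so this is the difference over
  the two edges.\<close>

lemma sin_cubed_diff:
  "sin (x + d) ^ 3 - sin (x - d) ^ 3 = (3 * sin d * cos x - sin (3 * d) * cos (3 * x)) / (2 :: real)"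
proof -
  have cubed: "sin u ^ 3 = (3 * sin u - sin (3 * u)) / 4" for u :: real
    by (simp add: sin_3)
  have 1: "sin (x + d) - sin (x - d) = 2 * sin d * cos x"
    by (simp add: sin_add sin_diff)
  have 3: "sin (3 * (x + d)) - sin (3 * (x - d)) = 2 * sin (3 * d) * cos (3 * x)"
    by (simp add: sin_add sin_diff algebra_simps)
  have "sin (x + d) ^ 3 - sin (x - d) ^ 3
    = (3 * (sin (x + d) - sin (x - d)) - (sin (3 * (x + d)) - sin (3 * (x - d)))) / 4"
    unfolding cubed by (simp add: field_simps)
  also have "\<dots> = (3 * sin d * cos x - sin (3 * d) * cos (3 * x)) / 2"
    unfolding 1 3 by simp
  finally show ?thesis .
qed

text \<open>Linearization of every product in the expansion, so that only the harmonics 1 to 4 have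
  to be summed.\<close>

lemma cos_products:
  fixes x :: real
  shows "(cos x)\<^sup>2 = (1 + cos (2 * x)) / 2"
    and "cos x ^ 3 = (3 * cos x + cos (3 * x)) / 4"
    and "cos x ^ 4 = (3 + 4 * cos (2 * x) + cos (4 * x)) / 8"
    and "cos x * cos (2 * x) = (cos x + cos (3 * x)) / 2"
    and "(cos x)\<^sup>2 * cos (2 * x) = (1 + 2 * cos (2 * x) + cos (4 * x)) / 4"
    and "(cos (2 * x))\<^sup>2 = (1 + cos (4 * x)) / 2"
    and "cos x * cos (3 * x) = (cos (2 * x) + cos (4 * x)) / 2"
proof -
  have 2: "cos (2 * x) = 2 * (cos x)\<^sup>2 - 1" by (rule cos_double_cos)
  have 4: "cos (4 * x) = 2 * (cos (2 * x))\<^sup>2 - 1" using cos_double_cos[of "2 * x"] by simp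
  have "cos (3 * x) = cos (2 * x + x)" by simp
  also have "\<dots> = (2 * (cos x)\<^sup>2 - 1) * cos x - 2 * (sin x)\<^sup>2 * cos x"
    by (simp only: cos_add sin_double cos_double_cos) (simp add: power2_eq_square)
  also have "\<dots> = 4 * cos x ^ 3 - 3 * cos x"
    unfolding sin_squared_eq by algebra
  finally have 3: "cos (3 * x) = 4 * cos x ^ 3 - 3 * cos x" .
  show "(cos x)\<^sup>2 = (1 + cos (2 * x)) / 2"
    "cos x ^ 3 = (3 * cos x + cos (3 * x)) / 4"
    "cos x ^ 4 = (3 + 4 * cos (2 * x) + cos (4 * x)) / 8"
    "cos x * cos (2 * x) = (cos x + cos (3 * x)) / 2"
    "(cos x)\<^sup>2 * cos (2 * x) = (1 + 2 * cos (2 * x) + cos (4 * x)) / 4"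
    "(cos (2 * x))\<^sup>2 = (1 + cos (4 * x)) / 2"
    "cos x * cos (3 * x) = (cos (2 * x) + cos (4 * x)) / 2"
    unfolding 4 3 2 by (simp_all add: field_simps) algebra+
qed

text \<open>Source of the exceptional cases of the theorem: harmonics up to 4 occur, and harmonic k
  survives the sum only if M divides k, which for M \<ge> 2 singles out M = 2, 3, 4.\<close>

lemma psk_moment_sums:
  fixes M :: nat
  assumes "2 \<le> M"
  defines "x \<equiv> \<lambda>l. 2 * pi * real l / real M"
  shows "(\<Sum>l<M. (cos (x l))\<^sup>2) = (if M = 2 then 2 else M / 2)"
    and "(\<Sum>l<M. cos (x l) ^ 3) = (if M = 3 then 3 / 4 else 0)"
    and "(\<Sum>l<M. cos (x l) * cos (2 * x l)) = (if M = 3 then 3 / 2 else 0)"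
    and "(\<Sum>l<M. cos (x l) ^ 4) = (if M = 2 then 2 else if M = 4 then 2 else 3 * real M / 8)"
    and "(\<Sum>l<M. (cos (x l))\<^sup>2 * cos (2 * x l)) = (if M = 2 then 2 else if M = 4 then 2 else M / 4)"
    and "(\<Sum>l<M. (cos (2 * x l))\<^sup>2) = (if M = 2 then 2 else if M = 4 then 4 else M / 2)"
    and "(\<Sum>l<M. cos (x l) * cos (3 * x l)) = (if M = 2 then 2 else if M = 4 then 2 else 0)"
proof -
  have dvd: "M dvd 1 \<longleftrightarrow> False" "M dvd 2 \<longleftrightarrow> M = 2" "M dvd 3 \<longleftrightarrow> M = 3" "M dvd 4 \<longleftrightarrow> M = 2 \<or> M = 4"
  proof -
    show "M dvd 1 \<longleftrightarrow> False" using assms(1) by auto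
    show "M dvd 2 \<longleftrightarrow> M = 2" using assms(1) dvd_imp_le[of M 2] by auto
    show "M dvd 3 \<longleftrightarrow> M = 3"
    proof
      assume *: "M dvd 3"
      then have "M \<le> 3" by (rule dvd_imp_le) simp
      with assms(1) have "M = 2 \<or> M = 3" by auto
      with * show "M = 3" by auto
    qed simp
    show "M dvd 4 \<longleftrightarrow> M = 2 \<or> M = 4"
    proof
      assume *: "M dvd 4"
      then have "M \<le> 4" by (rule dvd_imp_le) simp
      with assms(1) have "M = 2 \<or> M = 3 \<or> M = 4" by auto
      with * show "M = 2 \<or> M = 4" by auto
    qed auto
  qed
  have D: "(\<Sum>l<M. cos (real k * x l)) = (if M dvd k then real M else 0)" for k
    unfolding x_def using assms by (intro sum_cos_multiples) simp
  have "(\<Sum>l<M. cos (x l)) = 0" "(\<Sum>l<M. cos (2 * x l)) = (if M = 2 then real M else 0)"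
    "(\<Sum>l<M. cos (3 * x l)) = (if M = 3 then real M else 0)"
    "(\<Sum>l<M. cos (4 * x l)) = (if M = 2 \<or> M = 4 then real M else 0)"
    using D[of 1] D[of 2] D[of 3] D[of 4] dvd by simp_all
  note D' = this
  show "(\<Sum>l<M. (cos (x l))\<^sup>2) = (if M = 2 then 2 else M / 2)"
    "(\<Sum>l<M. cos (x l) ^ 3) = (if M = 3 then 3 / 4 else 0)"
    "(\<Sum>l<M. cos (x l) * cos (2 * x l)) = (if M = 3 then 3 / 2 else 0)"
    "(\<Sum>l<M. cos (x l) ^ 4) = (if M = 2 then 2 else if M = 4 then 2 else 3 * real M / 8)"
    "(\<Sum>l<M. (cos (x l))\<^sup>2 * cos (2 * x l)) = (if M = 2 then 2 else if M = 4 then 2 else M / 4)"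
    "(\<Sum>l<M. (cos (2 * x l))\<^sup>2) = (if M = 2 then 2 else if M = 4 then 4 else M / 2)"
    "(\<Sum>l<M. cos (x l) * cos (3 * x l)) = (if M = 2 then 2 else if M = 4 then 2 else 0)"
    \<comment> \<open>This product must be rewritten first, because the rule for
      \<open>(cos x)\<^sup>2\<close> would break up its first factor.\<close>
    unfolding cos_products(5)[of "x _"]
    unfolding cos_products(2-4,6,7)[of "x _"] cos_products(1)[of "x _"]
    by (simp_all only: sum_divide_distrib[symmetric] sum.distrib sum_distrib_left[symmetric] D') auto
qed

section \<open>Gaussian tails\<close>

text \<open>For an antiderivative F of f, splitting the tail at an intermediate point shows that
  \<open>k + F\<close> is constant. Finiteness of the tails is contained in k being
  real-valued.\<close>

lemma has_derivative_tail_integral: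
  fixes f k :: "real \<Rightarrow> real"
  assumes f: "continuous_on UNIV f" "\<And>s. 0 \<le> f s" and k: "\<And>t. 0 \<le> k t"
    and tail: "\<And>t. (\<integral>\<^sup>+s. ennreal (f s) * indicator {t..} s \<partial>lborel) = ennreal (k t)"
  shows "(k has_real_derivative - f t) (at t)"
proof -
  have "isCont f x" for x
    using f(1) by (simp add: continuous_on_eq_continuous_at)
  then have "\<exists>F. \<forall>x::real. - \<infinity> < ereal x \<longrightarrow> ereal x < \<infinity> \<longrightarrow> (F has_vector_derivative f x) (at x)"
    by (intro einterval_antiderivative) auto
  then obtain F where F: "(F has_real_derivative f x) (at x)" for x
    by (auto simp: has_real_derivative_iff_has_vector_derivative)
  have [measurable]: "f \<in> borel_measurable borel"
    using f(1) by (rule borel_measurable_continuous_onI)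
  have step: "k a + F a = k b + F b" if "a \<le> b" for a b
  proof -
    have "F a \<le> F b" using that F f(2) by (metis DERIV_nonneg_imp_nondecreasing)
    have "AE s in lborel. s \<noteq> b" by (rule AE_lborel_singleton)
    then have "(\<integral>\<^sup>+s. ennreal (f s) * indicator {a..} s \<partial>lborel)
      = (\<integral>\<^sup>+s. ennreal (f s) * indicator {a..b} s + ennreal (f s) * indicator {b..} s \<partial>lborel)"
      using that by (intro nn_integral_cong_AE) (auto split: split_indicator elim!: eventually_mono)
    also have "\<dots> = ennreal (F b - F a) + ennreal (k b)"
      by (subst nn_integral_add) (auto simp: tail nn_integral_FTC_Icc[OF _ F f(2) that])
    also have "\<dots> = ennreal (F b - F a + k b)"
      using \<open>F a \<le> F b\<close> k by (intro ennreal_plus[symmetric]) auto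
    finally have "ennreal (k a) = ennreal (F b - F a + k b)"
      unfolding tail .
    then show ?thesis
      using \<open>F a \<le> F b\<close> k[of a] k[of b] by (subst (asm) ennreal_inj) auto
  qed
  have "k x = k t + F t - F x" for x
    using step[of x t] step[of t x] by (cases "x \<le> t") linarith+
  then have "k = (\<lambda>x. k t + F t - F x)" by (rule ext)
  note keq = arg_cong[of _ _ "\<lambda>g. (g has_real_derivative - f t) (at t)", OF this]
  show ?thesis
    by (rule keq[THEN iffD2]) (auto intro!: derivative_eq_intros F)
qed

text \<open>This is \<open>sqrt pi / 2 * (1 + erf u)\<close> in terms of the error function. The
  lower limit is \<open>- u\<close> rather than u so that the function increases, with derivative
  \<open>exp (- u\<^sup>2)\<close>.\<close>

definition gauss_tail :: "real \<Rightarrow> real" where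
  "gauss_tail u = enn2real (\<integral>\<^sup>+v. ennreal (exp (- v\<^sup>2)) * indicator {- u..} v \<partial>lborel)"

lemma nn_integral_gauss_half:
  "(\<integral>\<^sup>+v. ennreal (exp (- v\<^sup>2)) * indicator {0..} v \<partial>lborel) = ennreal (sqrt pi / 2)"
proof -
  have "(\<integral>\<^sup>+v. ennreal (indicator {0..} v *\<^sub>R exp (- v\<^sup>2)) \<partial>lborel) = ennreal (sqrt pi / 2)"
    using gaussian_moment_0 by (subst nn_integral_eq_integral) (auto simp: has_bochner_integral_iff)
  then show ?thesis
    by (subst nn_integral_cong[where v = "\<lambda>v. ennreal (indicator {0..} v *\<^sub>R exp (- v\<^sup>2))"])
       (auto split: split_indicator)
qed

lemma nn_integral_gauss_half':
  "(\<integral>\<^sup>+v. ennreal (exp (- v\<^sup>2)) * indicator {..0} v \<partial>lborel) = ennreal (sqrt pi / 2)"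
  by (subst nn_integral_real_affine[where c = "-1" and t = 0])
     (auto simp: nn_integral_gauss_half[symmetric] intro!: nn_integral_cong split: split_indicator)

lemma nn_integral_gauss: "(\<integral>\<^sup>+v. ennreal (exp (- v\<^sup>2)) \<partial>lborel) = ennreal (sqrt pi)"
proof -
  have "AE v in lborel. v \<noteq> (0::real)" by (rule AE_lborel_singleton)
  then have "(\<integral>\<^sup>+v. ennreal (exp (- v\<^sup>2)) \<partial>lborel)
    = (\<integral>\<^sup>+v. ennreal (exp (- v\<^sup>2)) * indicator {..0} v + ennreal (exp (- v\<^sup>2)) * indicator {0..} v \<partial>lborel)"
    by (intro nn_integral_cong_AE) (auto split: split_indicator elim!: eventually_mono)
  also have "\<dots> = ennreal (sqrt pi)"
    by (subst nn_integral_add) (auto simp: nn_integral_gauss_half nn_integral_gauss_half' simp flip: ennreal_plus)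
  finally show ?thesis .
qed

lemma nn_integral_gauss_tail:
  "(\<integral>\<^sup>+v. ennreal (exp (- v\<^sup>2)) * indicator {- u..} v \<partial>lborel) = ennreal (gauss_tail u)"
proof -
  have "(\<integral>\<^sup>+v. ennreal (exp (- v\<^sup>2)) * indicator {- u..} v \<partial>lborel) \<le> (\<integral>\<^sup>+v. ennreal (exp (- v\<^sup>2)) \<partial>lborel)"
    by (intro nn_integral_mono) (auto split: split_indicator)
  also have "\<dots> < \<top>"
    by (simp add: nn_integral_gauss)
  finally show ?thesis
    by (simp add: gauss_tail_def)
qed

lemma gauss_tail_0: "gauss_tail 0 = sqrt pi / 2"
  by (simp add: gauss_tail_def nn_integral_gauss_half)

lemma gauss_tail_nonneg: "0 \<le> gauss_tail u"
  by (simp add: gauss_tail_def)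

lemma has_derivative_gauss_tail [derivative_intros]:
  assumes "(g has_real_derivative g') (at x within S)"
  shows "((\<lambda>x. gauss_tail (g x)) has_real_derivative exp (- (g x)\<^sup>2) * g') (at x within S)"
proof -
  have *: "((\<lambda>t. gauss_tail (- t)) has_real_derivative - exp (- t\<^sup>2)) (at t)" for t
    by (rule has_derivative_tail_integral)
       (auto intro!: continuous_intros gauss_tail_nonneg nn_integral_gauss_tail[of "- _", simplified])
  have "(gauss_tail has_real_derivative exp (- u\<^sup>2)) (at u)" for u
    using DERIV_chain2[where f = "\<lambda>t. gauss_tail (- t)" and g = uminus and x = u and s = UNIV, OF *, of "- 1"]
    by (simp add: DERIV_minus[OF DERIV_ident])
  then show ?thesis using assms by (rule DERIV_chain2)
qed

text \<open>Derivative, with respect to the shift, of the probability of a sector with edge direction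
  \<open>\<phi>\<close>: the flux of the Gaussian density through that edge.\<close>

definition ray_flux :: "real \<Rightarrow> real \<Rightarrow> real" where
  "ray_flux \<phi> t = sin \<phi> / pi * exp (- (t * sin \<phi>)\<^sup>2) * gauss_tail (t * cos \<phi>)"

lemma ray_flux_0: "ray_flux \<phi> 0 = sin \<phi> / (2 * sqrt pi)"
  using real_sqrt_mult_self[of pi] by (simp add: ray_flux_def gauss_tail_0 field_simps)

text \<open>In the derivative of \<open>ray_flux\<close> the two exponentials, from the factor and
  from the tail, merge into \<open>exp (- t\<^sup>2)\<close> by Pythagoras. Keeping
  \<open>ray_flux\<close> in the other term lets the next derivative at 0 be read off from
  \<open>ray_flux_0\<close>.\<close>

definition ray_flux_deriv :: "real \<Rightarrow> real \<Rightarrow> real" where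
  "ray_flux_deriv \<phi> t = - 2 * t * (sin \<phi>)\<^sup>2 * ray_flux \<phi> t + sin \<phi> * cos \<phi> / pi * exp (- t\<^sup>2)"

lemma ray_flux_deriv_0: "ray_flux_deriv \<phi> 0 = sin \<phi> * cos \<phi> / pi"
  by (simp add: ray_flux_deriv_def)

lemma has_derivative_ray_flux: "(ray_flux \<phi> has_real_derivative ray_flux_deriv \<phi> t) (at t)"
proof -
  have "(t * sin \<phi>)\<^sup>2 + (t * cos \<phi>)\<^sup>2 = t\<^sup>2"
    by (simp add: power_mult_distrib flip: distrib_left)
  then have *: "exp (- (t * sin \<phi>)\<^sup>2) * exp (- (t * cos \<phi>)\<^sup>2) = exp (- t\<^sup>2)"
    by (simp flip: exp_add)
  have "((\<lambda>t. exp (- (t * sin \<phi>)\<^sup>2) * gauss_tail (t * cos \<phi>)) has_real_derivative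
      exp (- (t * sin \<phi>)\<^sup>2) * (- (2 * (t * sin \<phi>) * sin \<phi>)) * gauss_tail (t * cos \<phi>)
       + exp (- (t * sin \<phi>)\<^sup>2) * (exp (- (t * cos \<phi>)\<^sup>2) * cos \<phi>)) (at t)"
    by (auto intro!: derivative_eq_intros simp: algebra_simps power2_eq_square)
  from DERIV_cmult[OF this, of "sin \<phi> / pi"]
  have "(ray_flux \<phi> has_real_derivative
      sin \<phi> / pi * (exp (- (t * sin \<phi>)\<^sup>2) * (- (2 * (t * sin \<phi>) * sin \<phi>)) * gauss_tail (t * cos \<phi>)
       + exp (- (t * sin \<phi>)\<^sup>2) * (exp (- (t * cos \<phi>)\<^sup>2) * cos \<phi>))) (at t)"
    unfolding ray_flux_def mult.assoc .
  also have "sin \<phi> / pi * (exp (- (t * sin \<phi>)\<^sup>2) * (- (2 * (t * sin \<phi>) * sin \<phi>)) * gauss_tail (t * cos \<phi>)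
       + exp (- (t * sin \<phi>)\<^sup>2) * (exp (- (t * cos \<phi>)\<^sup>2) * cos \<phi>))
    = - 2 * t * (sin \<phi>)\<^sup>2 * ray_flux \<phi> t
       + sin \<phi> * cos \<phi> / pi * (exp (- (t * sin \<phi>)\<^sup>2) * exp (- (t * cos \<phi>)\<^sup>2))"
    by (simp add: ray_flux_def power2_eq_square algebra_simps)
  finally show ?thesis unfolding * ray_flux_deriv_def .
qed

lemma has_derivative_ray_flux_deriv_0:
  "(ray_flux_deriv \<phi> has_real_derivative - (sin \<phi> ^ 3 / sqrt pi)) (at 0)"
  unfolding ray_flux_deriv_def
  by (auto intro!: derivative_eq_intros has_derivative_ray_flux simp: ray_flux_0 power2_eq_square power3_eq_cube)

lemma continuous_ray_flux: "continuous_on UNIV (ray_flux \<phi>)"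
  using has_derivative_ray_flux DERIV_isCont by (metis continuous_at_imp_continuous_on)

lemma ray_flux_nonneg: "0 \<le> sin \<phi> \<Longrightarrow> 0 \<le> ray_flux \<phi> t"
  by (simp add: ray_flux_def gauss_tail_nonneg)

text \<open>Counterpart of the point reflection that reduces an edge below the real axis to one
  above it.\<close>

lemma ray_flux_minus_pi: "ray_flux (\<phi> - pi) (- t) = - ray_flux \<phi> t"
  by (simp add: ray_flux_def)

section \<open>Wedge probabilities\<close>

text \<open>Law of the received point in units of \<open>sqrt N0\<close>, where \<open>t\<close> is the square root of the SNR.\<close>

definition received :: "real \<Rightarrow> (real \<times> real) measure" where
  "received t = density (lborel \<Otimes>\<^sub>M lborel) (\<lambda>(x, y). ennreal (exp (- (x - t)\<^sup>2 - y\<^sup>2) / pi))"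

lemma sets_received [measurable_cong]: "sets (received t) = sets (borel \<Otimes>\<^sub>M borel)"
  by (simp add: received_def cong: sets_pair_measure_cong)

lemma space_received [simp]: "space (received t) = UNIV"
  by (simp add: received_def space_pair_measure)

lemma sets_Collect_borel_pair:
  "Measurable.pred (borel \<Otimes>\<^sub>M borel) P \<Longrightarrow> {p :: real \<times> real. P p} \<in> sets (borel \<Otimes>\<^sub>M borel)"
  by (simp add: pred_def space_pair_measure)

lemma emeasure_received:
  assumes [measurable]: "S \<in> sets (borel \<Otimes>\<^sub>M borel)"
  shows "emeasure (received t) S
    = (\<integral>\<^sup>+y. \<integral>\<^sup>+x. ennreal (exp (- (x - t)\<^sup>2 - y\<^sup>2) / pi) * indicator S (x, y) \<partial>lborel \<partial>lborel)"
proof -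
  have "emeasure (received t) S = (\<integral>\<^sup>+p. (\<lambda>(x, y). ennreal (exp (- (x - t)\<^sup>2 - y\<^sup>2) / pi)) p * indicator S p \<partial>(lborel \<Otimes>\<^sub>M lborel))"
    unfolding received_def by (intro emeasure_density) measurable
  also have "\<dots> = (\<integral>\<^sup>+y. \<integral>\<^sup>+x. (\<lambda>(x, y). ennreal (exp (- (x - t)\<^sup>2 - y\<^sup>2) / pi)) (x, y) * indicator S (x, y) \<partial>lborel \<partial>lborel)"
    by (intro lborel_pair.nn_integral_snd[symmetric]) measurable
  finally show ?thesis by simp
qed

lemma AE_received: "AE p in lborel \<Otimes>\<^sub>M lborel. P p \<Longrightarrow> AE p in received t. P p"
  unfolding received_def by (subst AE_density) auto

lemma AE_received_im_nonzero: "AE p in received t. snd p \<noteq> 0"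
proof -
  have "AE x in lborel. AE y in lborel. snd (x, y :: real) \<noteq> 0"
    by (simp add: AE_lborel_singleton)
  then have "AE p in lborel \<Otimes>\<^sub>M lborel. snd (p :: real \<times> real) \<noteq> 0"
    by (intro lborel_pair.AE_pair_measure)
       (auto simp: space_pair_measure cong: sets_pair_measure_cong intro!: sets_Collect_borel_pair)
  then show ?thesis by (rule AE_received)
qed

lemma nn_integral_received_strip:
  "(\<integral>\<^sup>+x. ennreal (exp (- (x - t)\<^sup>2 - y\<^sup>2) / pi) \<partial>lborel) = ennreal (1 / sqrt pi) * ennreal (exp (- y\<^sup>2))"
proof -
  have "(\<integral>\<^sup>+x. ennreal (exp (- (x - t)\<^sup>2 - y\<^sup>2) / pi) \<partial>lborel)
    = (\<integral>\<^sup>+x. ennreal (exp (- y\<^sup>2) / pi) * ennreal (exp (- x\<^sup>2)) \<partial>lborel)"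
    by (subst nn_integral_real_affine[where c = 1 and t = t])
       (auto simp: exp_diff exp_minus field_simps simp flip: ennreal_mult intro!: nn_integral_cong)
  also have "\<dots> = ennreal (exp (- y\<^sup>2) / pi) * ennreal (sqrt pi)"
    by (subst nn_integral_cmult) (auto simp: nn_integral_gauss)
  also have "\<dots> = ennreal (1 / sqrt pi) * ennreal (exp (- y\<^sup>2))"
    using real_sqrt_mult_self[of pi] by (simp add: field_simps flip: ennreal_mult)
  finally show ?thesis .
qed

lemma prob_space_received: "prob_space (received t)"
proof
  have "emeasure (received t) UNIV = (\<integral>\<^sup>+y. \<integral>\<^sup>+x. ennreal (exp (- (x - t)\<^sup>2 - y\<^sup>2) / pi) \<partial>lborel \<partial>lborel)"
    using sets_Collect_borel_pair[of "\<lambda>_. True"] by (subst emeasure_received) auto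
  also have "\<dots> = ennreal (1 / sqrt pi) * ennreal (sqrt pi)"
    by (simp add: nn_integral_received_strip nn_integral_cmult nn_integral_gauss)
  finally show "emeasure (received t) (space (received t)) = 1"
    by (simp flip: ennreal_mult)
qed

text \<open>The real axis is a null set. Away from it the sign of y, the edge inequalities and the
  argument describe regions consistently, so identities between them need no boundary cases.\<close>

lemma measure_received_partition:
  assumes [measurable]: "A \<in> sets (borel \<Otimes>\<^sub>M borel)" "B \<in> sets (borel \<Otimes>\<^sub>M borel)" "C \<in> sets (borel \<Otimes>\<^sub>M borel)"
    and "\<And>x y. y \<noteq> 0 \<Longrightarrow> (x, y) \<in> A \<longleftrightarrow> (x, y) \<in> B \<or> (x, y) \<in> C"
    and "\<And>x y. y \<noteq> 0 \<Longrightarrow> \<not> ((x, y) \<in> B \<and> (x, y) \<in> C)"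
  shows "measure (received t) A = measure (received t) B + measure (received t) C"
proof -
  interpret prob_space "received t" by (rule prob_space_received)
  have "measure (received t) A = measure (received t) (B \<union> C)"
    using AE_received_im_nonzero[of t] assms(4)
    by (intro measure_eq_AE) (auto elim!: eventually_mono)
  also have "\<dots> = measure (received t) B + measure (received t) C"
    using AE_received_im_nonzero[of t] assms(5)
    by (intro measure_Un_AE) (auto simp: fmeasurable_eq_sets elim!: eventually_mono)
  finally show ?thesis .
qed

text \<open>The shift is parallel to the real axis: integrating over x first removes t and leaves a
  symmetric Gaussian in y.\<close>

lemma measure_received_lower_half: "measure (received t) {(x, y). y \<le> 0} = 1 / 2"
proof -
  have "{(x, y). y \<le> (0::real)} \<in> sets (borel \<Otimes>\<^sub>M borel :: (real \<times> real) measure)"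
    by (rule sets_Collect_borel_pair) measurable
  then have "emeasure (received t) {(x, y). y \<le> 0}
    = (\<integral>\<^sup>+y. (\<integral>\<^sup>+x. ennreal (exp (- (x - t)\<^sup>2 - y\<^sup>2) / pi) \<partial>lborel) * indicator {..0} y \<partial>lborel)"
    by (subst emeasure_received)
       (auto simp flip: nn_integral_multc intro!: nn_integral_cong split: split_indicator)
  also have "\<dots> = (\<integral>\<^sup>+y. ennreal (1 / sqrt pi) * (ennreal (exp (- y\<^sup>2)) * indicator {..0} y) \<partial>lborel)"
    by (simp add: nn_integral_received_strip mult.assoc)
  also have "\<dots> = ennreal (1 / sqrt pi) * ennreal (sqrt pi / 2)"
    by (subst nn_integral_cmult) (auto simp: nn_integral_gauss_half')
  also have "\<dots> = ennreal (1 / 2)"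
    by (simp flip: ennreal_mult)
  finally show ?thesis
    by (rule measure_eq_emeasure_eq_ennreal[rotated]) simp
qed

text \<open>For \<phi> between 0 and pi these are the points of the closed upper half-plane with
  argument at least \<phi>, up to the boundary axis. The sign of a cross product expresses the
  comparison of angles without dividing by a sine or cosine.\<close>

definition upper_wedge :: "real \<Rightarrow> (real \<times> real) set" where
  "upper_wedge \<phi> = {(x, y). 0 \<le> y \<and> x * sin \<phi> \<le> y * cos \<phi>}"

lemma measurable_upper_wedge [measurable]: "upper_wedge \<phi> \<in> sets (borel \<Otimes>\<^sub>M borel)"
  unfolding upper_wedge_def by (rule sets_Collect_borel_pair) measurable

lemma upper_wedge_iff:
  "0 < \<phi> \<Longrightarrow> \<phi> < pi \<Longrightarrow> (x, y) \<in> upper_wedge \<phi> \<longleftrightarrow> 0 \<le> y \<and> x \<le> y * cot \<phi>"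
  using sin_gt_zero[of \<phi>] by (simp add: upper_wedge_def cot_def field_simps)

text \<open>Substituting \<open>x = t + y * cot \<phi> - s\<close> makes the wedge independent of \<open>t\<close> apart from the range \<open>s \<ge> t\<close>.\<close>

lemma emeasure_upper_wedge:
  assumes "0 < \<phi>" "\<phi> < pi"
  shows "emeasure (received t) (upper_wedge \<phi>)
    = (\<integral>\<^sup>+s. ennreal (ray_flux \<phi> s) * indicator {t..} s \<partial>lborel)"
proof -
  have sin: "0 < sin \<phi>" using assms by (rule sin_gt_zero)
  let ?g = "\<lambda>s y. ennreal (exp (- (y * cot \<phi> - s)\<^sup>2 - y\<^sup>2) / pi) * indicator {0..} y * indicator {t..} s"
  have "emeasure (received t) (upper_wedge \<phi>) = (\<integral>\<^sup>+y. \<integral>\<^sup>+s. ?g s y \<partial>lborel \<partial>lborel)"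
    unfolding emeasure_received[OF measurable_upper_wedge]
  proof (rule nn_integral_cong)
    fix y :: real
    show "(\<integral>\<^sup>+x. ennreal (exp (- (x - t)\<^sup>2 - y\<^sup>2) / pi) * indicator (upper_wedge \<phi>) (x, y) \<partial>lborel)
      = (\<integral>\<^sup>+s. ?g s y \<partial>lborel)"
      by (subst nn_integral_real_affine[where c = "-1" and t = "t + y * cot \<phi>"])
         (auto simp: upper_wedge_iff[OF assms] intro!: nn_integral_cong split: split_indicator)
  qed
  also have "\<dots> = (\<integral>\<^sup>+s. \<integral>\<^sup>+y. ?g s y \<partial>lborel \<partial>lborel)"
    by (rule lborel_pair.Fubini') measurable
  also have "\<dots> = (\<integral>\<^sup>+s. ennreal (ray_flux \<phi> s) * indicator {t..} s \<partial>lborel)"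
  proof (intro nn_integral_cong)
    fix s :: real
    let ?c = "exp (- (s * sin \<phi>)\<^sup>2) / pi"
    \<comment> \<open>The point with height y on the ray is at distance r = y /
      \<open>sin \<phi>\<close> from the origin, and \<open>r = s * cos \<phi> + v\<close> measures
      it from the foot of the perpendicular dropped from \<open>(s, 0)\<close>. Pythagoras splits
      the squared distance to \<open>(s, 0)\<close>.\<close>
    have sq: "((s * cos \<phi> * sin \<phi> + sin \<phi> * v) * cot \<phi> - s)\<^sup>2 + (s * cos \<phi> * sin \<phi> + sin \<phi> * v)\<^sup>2
      = (s * sin \<phi>)\<^sup>2 + v\<^sup>2" for v
    proof -
      have "(s * cos \<phi> * sin \<phi> + sin \<phi> * v) * cot \<phi> = (s * cos \<phi> + v) * cos \<phi>"
        using sin by (simp add: cot_def field_simps)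
      \<comment> \<open>The relation between sine and cosine appears as an explicit factor, which
        leaves a polynomial identity.\<close>
      moreover have "((s * cos \<phi> + v) * cos \<phi> - s)\<^sup>2 + (s * cos \<phi> * sin \<phi> + sin \<phi> * v)\<^sup>2
          - ((s * sin \<phi>)\<^sup>2 + v\<^sup>2)
        = ((sin \<phi>)\<^sup>2 + (cos \<phi>)\<^sup>2 - 1) * ((s * cos \<phi> + v)\<^sup>2 - s\<^sup>2)"
        by algebra
      ultimately show ?thesis by simp
    qed
    have density: "exp (- ((s * cos \<phi> * sin \<phi> + sin \<phi> * v) * cot \<phi> - s)\<^sup>2 - (s * cos \<phi> * sin \<phi> + sin \<phi> * v)\<^sup>2) / pi
      = ?c * exp (- v\<^sup>2)" for v
    proof -
      have "- ((s * cos \<phi> * sin \<phi> + sin \<phi> * v) * cot \<phi> - s)\<^sup>2 - (s * cos \<phi> * sin \<phi> + sin \<phi> * v)\<^sup>2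
        = - (s * sin \<phi>)\<^sup>2 + - v\<^sup>2"
        using sq[of v] by linarith
      then show ?thesis by (simp only: exp_add times_divide_eq_left)
    qed
    have range: "0 \<le> s * cos \<phi> * sin \<phi> + sin \<phi> * v \<longleftrightarrow> - (s * cos \<phi>) \<le> v" for v
    proof -
      have "0 \<le> s * cos \<phi> * sin \<phi> + sin \<phi> * v \<longleftrightarrow> 0 \<le> sin \<phi> * (s * cos \<phi> + v)"
        by (simp add: algebra_simps)
      also have "\<dots> \<longleftrightarrow> - (s * cos \<phi>) \<le> v"
        using sin by (auto simp: zero_le_mult_iff)
      finally show ?thesis .
    qed
    have ind: "indicator {0..} (s * cos \<phi> * sin \<phi> + sin \<phi> * v) = (indicator {- (s * cos \<phi>)..} v :: ennreal)" for v
      by (simp add: indicator_def range)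
    let ?f = "\<lambda>y. ennreal (exp (- (y * cot \<phi> - s)\<^sup>2 - y\<^sup>2) / pi) * indicator {0..} y"
    have "(\<integral>\<^sup>+y. ?f y \<partial>lborel)
      = ennreal \<bar>sin \<phi>\<bar> * (\<integral>\<^sup>+v. ?f (s * cos \<phi> * sin \<phi> + sin \<phi> * v) \<partial>lborel)"
      using sin by (intro nn_integral_real_affine) auto
    also have "\<dots> = ennreal (sin \<phi>) * (\<integral>\<^sup>+v. ennreal ?c * (ennreal (exp (- v\<^sup>2)) * indicator {- (s * cos \<phi>)..} v) \<partial>lborel)"
      unfolding density ind using sin by (simp add: ennreal_mult mult.assoc del: times_divide_eq_left)
    also have "\<dots> = ennreal (ray_flux \<phi> s)"
      using sin by (subst nn_integral_cmult)
        (auto simp: nn_integral_gauss_tail ray_flux_def gauss_tail_nonneg simp flip: ennreal_mult)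
    finally show "(\<integral>\<^sup>+y. ?g s y \<partial>lborel) = ennreal (ray_flux \<phi> s) * indicator {t..} s"
      by (simp add: nn_integral_multc)
  qed
  finally show ?thesis .
qed

lemma has_derivative_measure_upper_wedge:
  assumes "0 < \<phi>" "\<phi> < pi"
  shows "((\<lambda>t. measure (received t) (upper_wedge \<phi>)) has_real_derivative - ray_flux \<phi> t) (at t)"
proof (rule has_derivative_tail_integral[OF continuous_ray_flux])
  show "0 \<le> ray_flux \<phi> s" for s
    using assms by (intro ray_flux_nonneg sin_ge_zero) auto
  fix t
  interpret prob_space "received t" by (rule prob_space_received)
  show "(\<integral>\<^sup>+s. ennreal (ray_flux \<phi> s) * indicator {t..} s \<partial>lborel) = ennreal (measure (received t) (upper_wedge \<phi>))"
    using emeasure_upper_wedge[OF assms, of t] by (simp add: emeasure_eq_measure)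
qed simp

text \<open>Substituting \<open>x = y * w\<close> decouples the two integrals.\<close>

lemma measure_upper_wedge_0:
  assumes "0 < \<phi>" "\<phi> < pi"
  shows "measure (received 0) (upper_wedge \<phi>) = (pi - \<phi>) / (2 * pi)"
proof -
  let ?g = "\<lambda>w y. ennreal (y * exp (- (y\<^sup>2 * (1 + w\<^sup>2))) / pi) * indicator {0..} y * indicator {..cot \<phi>} w"
  have "emeasure (received 0) (upper_wedge \<phi>) = (\<integral>\<^sup>+y. \<integral>\<^sup>+w. ?g w y \<partial>lborel \<partial>lborel)"
    unfolding emeasure_received[OF measurable_upper_wedge]
  \<comment> \<open>Equality holds only almost everywhere in y, since the substitution degenerates
    at y = 0.\<close>
  proof (intro nn_integral_cong_AE)
    have "(\<integral>\<^sup>+x. ennreal (exp (- (x - 0)\<^sup>2 - y\<^sup>2) / pi) * indicator (upper_wedge \<phi>) (x, y) \<partial>lborel)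
      = (\<integral>\<^sup>+w. ?g w y \<partial>lborel)" if "y \<noteq> 0" for y :: real
    proof (subst nn_integral_real_affine[where c = y and t = 0])
      have "y \<le> 0 \<or> 0 < y" by auto
      then show "ennreal \<bar>y\<bar> * (\<integral>\<^sup>+w. ennreal (exp (- (0 + y * w - 0)\<^sup>2 - y\<^sup>2) / pi)
          * indicator (upper_wedge \<phi>) (0 + y * w, y) \<partial>lborel) = (\<integral>\<^sup>+w. ?g w y \<partial>lborel)"
      proof
        assume "0 < y"
        then show ?thesis
          by (subst nn_integral_cmult[symmetric])
             (auto simp: upper_wedge_iff[OF assms] power_mult_distrib algebra_simps
               simp flip: ennreal_mult intro!: nn_integral_cong split: split_indicator)
      qed (use that in \<open>simp add: upper_wedge_iff[OF assms]\<close>)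
    qed (use that in auto)
    then show "AE y in lborel. (\<integral>\<^sup>+x. ennreal (exp (- (x - 0)\<^sup>2 - y\<^sup>2) / pi) * indicator (upper_wedge \<phi>) (x, y) \<partial>lborel)
      = (\<integral>\<^sup>+w. ?g w y \<partial>lborel)"
      using AE_lborel_singleton[of 0] by (auto elim!: eventually_mono)
  qed
  also have "\<dots> = (\<integral>\<^sup>+w. \<integral>\<^sup>+y. ?g w y \<partial>lborel \<partial>lborel)"
    by (rule lborel_pair.Fubini') measurable
  also have "\<dots> = (\<integral>\<^sup>+w. ennreal (1 / (2 * pi * (1 + w\<^sup>2))) * indicator {..cot \<phi>} w \<partial>lborel)"
  proof (intro nn_integral_cong)
    fix w :: real
    have pos: "0 < 1 + w\<^sup>2" by (simp add: add_pos_nonneg)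
    have "(\<integral>\<^sup>+y. ennreal (y * exp (- (y\<^sup>2 * (1 + w\<^sup>2))) / pi) * indicator {0..} y \<partial>lborel)
      = ennreal (0 - (- exp (- (0\<^sup>2 * (1 + w\<^sup>2))) / (2 * pi * (1 + w\<^sup>2))))"
    proof (rule nn_integral_FTC_atLeast)
      show "((\<lambda>y. - exp (- (y\<^sup>2 * (1 + w\<^sup>2))) / (2 * pi * (1 + w\<^sup>2)))
        has_real_derivative y * exp (- (y\<^sup>2 * (1 + w\<^sup>2))) / pi) (at y)" for y
        using pos by (auto intro!: derivative_eq_intros)
      have "filterlim (\<lambda>y::real. y\<^sup>2 * (1 + w\<^sup>2)) at_top at_top"
        using pos by (intro filterlim_at_top_mult_tendsto_pos[OF tendsto_const] filterlim_pow_at_top filterlim_ident) auto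
      then have "((\<lambda>y. exp (- (y\<^sup>2 * (1 + w\<^sup>2)))) \<longlongrightarrow> 0) at_top"
        by (intro filterlim_compose[OF exp_at_bot] filterlim_compose[OF filterlim_uminus_at_bot_at_top])
      then show "((\<lambda>y. - exp (- (y\<^sup>2 * (1 + w\<^sup>2))) / (2 * pi * (1 + w\<^sup>2))) \<longlongrightarrow> 0) at_top"
        using tendsto_mult[OF tendsto_const, of _ 0 at_top "- 1 / (2 * pi * (1 + w\<^sup>2))"] by simp
    qed auto
    then show "(\<integral>\<^sup>+y. ?g w y \<partial>lborel) = ennreal (1 / (2 * pi * (1 + w\<^sup>2))) * indicator {..cot \<phi>} w"
      by (simp add: nn_integral_multc)
  qed
  also have "\<dots> = (\<integral>\<^sup>+w. ennreal (1 / (2 * pi * (1 + w\<^sup>2))) * indicator {- cot \<phi>..} w \<partial>lborel)"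
    by (subst nn_integral_real_affine[where c = "-1" and t = 0])
       (auto intro!: nn_integral_cong split: split_indicator)
  also have "\<dots> = ennreal (pi / 2 / (2 * pi) - arctan (- cot \<phi>) / (2 * pi))"
  proof (rule nn_integral_FTC_atLeast)
    show "((\<lambda>w. arctan w / (2 * pi)) has_real_derivative 1 / (2 * pi * (1 + w\<^sup>2))) (at w)" for w
      using DERIV_cdivide[OF DERIV_arctan[of w], of "2 * pi"]
      by (simp add: inverse_eq_divide mult.commute)
    show "((\<lambda>w. arctan w / (2 * pi)) \<longlongrightarrow> pi / 2 / (2 * pi)) at_top"
      by (intro tendsto_intros tendsto_arctan_at_top) auto
  qed auto
  also have "arctan (- cot \<phi>) = \<phi> - pi / 2"
  proof (rule arctan_unique)
    show "tan (\<phi> - pi / 2) = - cot \<phi>"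
      by (simp add: tan_def cot_def sin_diff cos_diff)
  qed (use assms in auto)
  also have "pi / 2 / (2 * pi) - (\<phi> - pi / 2) / (2 * pi) = (pi - \<phi>) / (2 * pi)"
    by (simp add: field_simps)
  finally show ?thesis
    using assms by (simp add: measure_def)
qed

section \<open>Scaling, reflection and null sets\<close>

text \<open>Serves two purposes: \<open>c = - 1\<close> is the reflection in the origin, and
  \<open>c = sqrt N0\<close> normalizes the noise.\<close>

lemma nn_integral_affine_plane:
  fixes f :: "real \<times> real \<Rightarrow> ennreal"
  assumes f [measurable]: "f \<in> borel_measurable (borel \<Otimes>\<^sub>M borel)" and c: "c \<noteq> 0"
  shows "(\<integral>\<^sup>+y. \<integral>\<^sup>+x. f (x, y) \<partial>lborel \<partial>lborel)
    = (\<integral>\<^sup>+y. \<integral>\<^sup>+x. ennreal (c\<^sup>2) * f (s + c * x, c * y) \<partial>lborel \<partial>lborel)"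
proof -
  have swap: "(\<lambda>(y, x). f (x, y)) \<in> borel_measurable (borel \<Otimes>\<^sub>M lborel)"
    using measurable_compose[OF measurable_pair_swap' f]
    by (simp add: case_prod_beta' cong: measurable_cong_sets sets_pair_measure_cong)
  have inner: "(\<lambda>y. \<integral>\<^sup>+x. f (x, y) \<partial>lborel) \<in> borel_measurable borel"
    by (rule lborel.borel_measurable_nn_integral[OF swap])
  have scaled: "(\<lambda>y. \<integral>\<^sup>+x. f (x, c * y) \<partial>lborel) \<in> borel_measurable borel"
    by (rule measurable_compose[OF _ inner]) simp
  have "(\<integral>\<^sup>+y. \<integral>\<^sup>+x. f (x, y) \<partial>lborel \<partial>lborel)
    = ennreal \<bar>c\<bar> * (\<integral>\<^sup>+y. \<integral>\<^sup>+x. f (x, 0 + c * y) \<partial>lborel \<partial>lborel)"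
    by (rule nn_integral_real_affine[OF inner c])
  also have "\<dots> = (\<integral>\<^sup>+y. ennreal \<bar>c\<bar> * (\<integral>\<^sup>+x. f (x, c * y) \<partial>lborel) \<partial>lborel)"
    using scaled by (simp add: nn_integral_cmult)
  also have "\<dots> = (\<integral>\<^sup>+y. ennreal \<bar>c\<bar> * (ennreal \<bar>c\<bar> * (\<integral>\<^sup>+x. f (s + c * x, c * y) \<partial>lborel)) \<partial>lborel)"
    by (intro nn_integral_cong arg_cong[of _ _ "(*) _"] nn_integral_real_affine c) measurable
  also have "\<dots> = (\<integral>\<^sup>+y. \<integral>\<^sup>+x. ennreal \<bar>c\<bar> * (ennreal \<bar>c\<bar> * f (s + c * x, c * y)) \<partial>lborel \<partial>lborel)"
    by (simp add: nn_integral_cmult)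
  finally show ?thesis
    by (simp add: power2_eq_square flip: ennreal_mult mult.assoc)
qed

text \<open>The noise law is invariant under reflection, so only the sign of the signal changes.
  This carries the wedge results over to angles between pi and 2 pi.\<close>

lemma measure_received_uminus:
  assumes [measurable]: "S \<in> sets (borel \<Otimes>\<^sub>M borel)"
  shows "measure (received t) {(x, y). (- x, - y) \<in> S} = measure (received (- t)) S"
proof -
  have [measurable]: "{(x, y). (- x, - y) \<in> S} \<in> sets (borel \<Otimes>\<^sub>M borel)"
    by (rule sets_Collect_borel_pair) measurable
  define f where "f p = ennreal (exp (- (fst p - - t)\<^sup>2 - (snd p)\<^sup>2) / pi) * indicator S p" for p
  have f: "f \<in> borel_measurable (borel \<Otimes>\<^sub>M borel)"
    unfolding f_def by measurable
  have "emeasure (received (- t)) S = (\<integral>\<^sup>+y. \<integral>\<^sup>+x. f (x, y) \<partial>lborel \<partial>lborel)"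
    by (simp add: emeasure_received f_def)
  also have "\<dots> = (\<integral>\<^sup>+y. \<integral>\<^sup>+x. f (- x, - y) \<partial>lborel \<partial>lborel)"
    using nn_integral_affine_plane[OF f, of "- 1" 0] by simp
  also have "\<dots> = emeasure (received t) {(x, y). (- x, - y) \<in> S}"
    by (subst emeasure_received)
       (auto simp: f_def power2_commute intro!: nn_integral_cong split: split_indicator)
  finally show ?thesis by (simp add: measure_def)
qed

text \<open>The densities are positive everywhere, so all these laws have the null sets of Lebesgue
  measure. Hence a sector, having probability 1/M at t = 0, has positive probability for every t,
  and its logarithm is differentiable.\<close>

lemma measure_received_eq_0:
  assumes [measurable]: "S \<in> sets (borel \<Otimes>\<^sub>M borel)" and "measure (received s) S = 0"
  shows "measure (received t) S = 0"
proof -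
  interpret prob_space "received s" by (rule prob_space_received)
  have "S \<in> null_sets (received s)"
    using assms by (auto simp: null_sets_def emeasure_eq_measure sets_received)
  then have "S \<in> null_sets (received t)"
    unfolding received_def by (subst (asm) null_sets_density_iff, simp, subst null_sets_density_iff) auto
  then show ?thesis by (auto simp: null_sets_def measure_def)
qed

section \<open>Sector probabilities\<close>

lemma measurable_Complex [measurable]:
  "(\<lambda>p. Complex (fst p) (snd p)) \<in> borel_measurable (borel \<Otimes>\<^sub>M borel)"
proof -
  have "(\<lambda>p. Complex (fst p) (snd p)) = (\<lambda>p. of_real (fst p) + \<i> * of_real (snd p))"
    by (simp add: complex_eq_iff fun_eq_iff)
  also have "\<dots> \<in> borel_measurable (borel \<Otimes>\<^sub>M borel)"
    by measurable
  finally show ?thesis .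
qed

text \<open>The half-open range of angles is an increasing union of compact intervals, so the sector is
  \<open>\<sigma>\<close>-compact.\<close>

lemma borel_decision_region [measurable]: "decision_region M l \<in> sets borel"
proof -
  define a where "a = (2 * real l - 1) * pi / real M"
  define b where "b = (2 * real l + 1) * pi / real M"
  let ?f = "\<lambda>(\<rho>, \<theta>). of_real \<rho> * cis \<theta>"
  have "decision_region M l = (\<Union>n::nat. ?f ` ({0..real n} \<times> {a..b - inverse (real (Suc n))}))"
  proof (intro equalityI subsetI)
    fix z assume "z \<in> decision_region M l"
    then obtain \<rho> \<theta> where z: "z = of_real \<rho> * cis \<theta>" "0 \<le> \<rho>" "a \<le> \<theta>" "\<theta> < b"
      by (auto simp: decision_region_def a_def b_def)
    obtain n1 :: nat where n1: "\<rho> \<le> real n1" using real_arch_simple by blast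
    obtain n2 where n2: "inverse (real (Suc n2)) < b - \<theta>"
      using reals_Archimedean[of "b - \<theta>"] z by auto
    have "inverse (real (Suc (max n1 n2))) \<le> inverse (real (Suc n2))"
      by (intro le_imp_inverse_le) auto
    then have "\<theta> \<le> b - inverse (real (Suc (max n1 n2)))"
      using n2 by linarith
    then have "(\<rho>, \<theta>) \<in> {0..real (max n1 n2)} \<times> {a..b - inverse (real (Suc (max n1 n2)))}"
      using z n1 by auto
    then show "z \<in> (\<Union>n::nat. ?f ` ({0..real n} \<times> {a..b - inverse (real (Suc n))}))"
      using z(1) by (intro UN_I[OF UNIV_I] image_eqI[rotated]) auto
  next
    fix z assume "z \<in> (\<Union>n::nat. ?f ` ({0..real n} \<times> {a..b - inverse (real (Suc n))}))"
    then obtain n \<rho> \<theta> where "z = of_real \<rho> * cis \<theta>" "0 \<le> \<rho>" "a \<le> \<theta>" "\<theta> \<le> b - inverse (real (Suc n))"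
      by auto
    moreover have "0 < inverse (real (Suc n))" by simp
    ultimately have "z = of_real \<rho> * cis \<theta> \<and> 0 \<le> \<rho> \<and> a \<le> \<theta> \<and> \<theta> < b" by linarith
    then show "z \<in> decision_region M l"
      unfolding decision_region_def a_def b_def by blast
  qed
  moreover have "?f ` ({0..real n} \<times> {a..b - inverse (real (Suc n))}) \<in> sets borel" for n
  proof -
    have "continuous_on ({0..real n} \<times> {a..b - inverse (real (Suc n))}) ?f"
      by (auto simp: case_prod_beta' intro!: continuous_intros)
    then have "compact (?f ` ({0..real n} \<times> {a..b - inverse (real (Suc n))}))"
      by (intro compact_continuous_image compact_Times) auto
    then show ?thesis by (intro borel_closed compact_imp_closed)
  qed
  ultimately show ?thesis by auto
qed

text \<open>Sectors are cones, so the unit of length is free; this is why the noise level enters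
  only through the SNR.\<close>

lemma decision_region_scale:
  assumes "0 < c"
  shows "of_real c * z \<in> decision_region M l \<longleftrightarrow> z \<in> decision_region M l"
proof -
  have *: "of_real c * z \<in> decision_region M l" if "z \<in> decision_region M l" "0 < c" for c z
    using that unfolding decision_region_def
    by clarsimp (metis mult.assoc mult_nonneg_nonneg less_imp_le of_real_mult)
  have "of_real (inverse c) * (of_real c * z) = z" using assms by simp
  then show ?thesis
    using *[of z c] *[of "of_real c * z" "inverse c"] assms by (metis positive_imp_inverse_positive)
qed

definition sector_event :: "nat \<Rightarrow> nat \<Rightarrow> (real \<times> real) set" where
  "sector_event M l = {(x, y). Complex x y \<in> decision_region M l}"

lemma measurable_sector_event [measurable]: "sector_event M l \<in> sets (borel \<Otimes>\<^sub>M borel)"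
  unfolding sector_event_def case_prod_beta' by (rule sets_Collect_borel_pair) measurable

text \<open>Dividing the received signal by \<open>sqrt N0\<close> gives noise with density
  \<open>exp (- x\<^sup>2 - y\<^sup>2) / pi\<close> and the signal point \<open>sqrt snr\<close> on
  the real axis.\<close>

lemma psk_prob_eq_received:
  assumes "0 < N0" "0 \<le> snr"
  shows "psk_prob M N0 (snr * N0) l 0 = measure (received (sqrt snr)) (sector_event M l)"
proof -
  define r where "r = sqrt N0"
  define t where "t = sqrt snr"
  have r: "0 < r" "r\<^sup>2 = N0" using assms by (auto simp: r_def)
  let ?nd = "\<lambda>x. ennreal (normal_density 0 (sqrt (N0 / 2)) x)"
  let ?D = "density lborel ?nd"
  define A where "A = {n. of_real (r * t) + n \<in> decision_region M l}"
  have sg: "sigma_finite_measure ?D"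
    using assms by (intro prob_space_imp_sigma_finite prob_space_normal_density) auto
  have A [measurable]: "A \<in> sets borel"
  proof -
    have "(\<lambda>n. of_real (r * t) + n) -` decision_region M l \<inter> space borel \<in> sets (borel :: complex measure)"
      by (rule measurable_sets[OF _ borel_decision_region]) simp
    then show ?thesis by (simp add: A_def vimage_def)
  qed
  have nd: "normal_density 0 (sqrt (N0 / 2)) (r * x) = exp (- x\<^sup>2) / (sqrt pi * r)" for x
    using assms r by (simp add: normal_density_def power_mult_distrib r_def real_sqrt_mult)
  define f where "f p = ?nd (fst p) * ?nd (snd p) * indicator {p. Complex (fst p) (snd p) \<in> A} p" for p
  have [measurable]: "{p. Complex (fst p) (snd p) \<in> A} \<in> sets (borel \<Otimes>\<^sub>M borel)"
    by (rule sets_Collect_borel_pair) measurable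
  have f: "f \<in> borel_measurable (borel \<Otimes>\<^sub>M borel)"
    unfolding f_def by measurable
  have "emeasure (complex_noise N0) A
    = emeasure (?D \<Otimes>\<^sub>M ?D) ((\<lambda>(x, y). Complex x y) -` A \<inter> space (?D \<Otimes>\<^sub>M ?D))"
    unfolding complex_noise_def by (rule emeasure_distr) (auto simp: case_prod_beta' cong: measurable_cong_sets sets_pair_measure_cong)
  also have "?D \<Otimes>\<^sub>M ?D = density (lborel \<Otimes>\<^sub>M lborel) (\<lambda>(x, y). ?nd x * ?nd y)"
    by (rule pair_measure_density) (auto intro: sg lborel.sigma_finite_measure_axioms)
  also have "emeasure \<dots> ((\<lambda>(x, y). Complex x y) -` A \<inter> space \<dots>)
    = (\<integral>\<^sup>+p. (case p of (x, y) \<Rightarrow> ?nd x * ?nd y) * indicator {p. Complex (fst p) (snd p) \<in> A} p \<partial>(lborel \<Otimes>\<^sub>M lborel))"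
  proof (subst emeasure_density)
    show "(\<lambda>(x, y). Complex x y) -` A \<inter> space (density (lborel \<Otimes>\<^sub>M lborel) (\<lambda>(x, y). ?nd x * ?nd y)) \<in> sets (lborel \<Otimes>\<^sub>M lborel)"
      by (simp add: vimage_def case_prod_beta' space_pair_measure cong: sets_pair_measure_cong)
  qed (auto simp: space_pair_measure case_prod_beta' intro!: nn_integral_cong split: split_indicator)
  also have "\<dots> = (\<integral>\<^sup>+y. \<integral>\<^sup>+x. f (x, y) \<partial>lborel \<partial>lborel)"
    by (subst lborel_pair.nn_integral_snd[symmetric]) (auto simp: f_def)
  \<comment> \<open>The integration variable of f is the noise, here written as r times the
    difference between the normalized received point and t.\<close>
  also have "\<dots> = (\<integral>\<^sup>+y. \<integral>\<^sup>+x. ennreal (r\<^sup>2) * f (- (r * t) + r * x, r * y) \<partial>lborel \<partial>lborel)"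
    using r by (intro nn_integral_affine_plane f) auto
  also have "\<dots> = (\<integral>\<^sup>+y. \<integral>\<^sup>+x. ennreal (exp (- (x - t)\<^sup>2 - y\<^sup>2) / pi) * indicator (sector_event M l) (x, y) \<partial>lborel \<partial>lborel)"
  proof -
    have "ennreal (r\<^sup>2) * f (- (r * t) + r * x, r * y)
      = ennreal (exp (- (x - t)\<^sup>2 - y\<^sup>2) / pi) * indicator (sector_event M l) (x, y)" for x y
    proof -
      have "of_real (r * t) + Complex (- (r * t) + r * x) (r * y) = of_real r * Complex x y"
        by (simp add: complex_eq_iff)
      then have "Complex (- (r * t) + r * x) (r * y) \<in> A \<longleftrightarrow> (x, y) \<in> sector_event M l"
        using decision_region_scale[OF r(1)] by (simp add: A_def sector_event_def)
      moreover have "r\<^sup>2 * (normal_density 0 (sqrt (N0 / 2)) (- (r * t) + r * x) * normal_density 0 (sqrt (N0 / 2)) (r * y))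
        = exp (- (x - t)\<^sup>2 - y\<^sup>2) / pi"
      proof -
        have "- (r * t) + r * x = r * (x - t)" by (simp add: algebra_simps)
        moreover have "exp (- (x - t)\<^sup>2 - y\<^sup>2) = exp (- (x - t)\<^sup>2) * exp (- y\<^sup>2)"
          by (simp flip: exp_add)
        moreover have "r\<^sup>2 * (a / (sqrt pi * r) * (b / (sqrt pi * r))) = a * b / pi" for a b
          using r(1) by (simp add: power2_eq_square)
        ultimately show ?thesis by (simp only: nd)
      qed
      ultimately show ?thesis
        by (simp add: f_def indicator_def mult.assoc flip: ennreal_mult)
    qed
    then show ?thesis by simp
  qed
  also have "\<dots> = emeasure (received t) (sector_event M l)"
    by (rule emeasure_received[symmetric]) simp
  finally have "measure (complex_noise N0) A = measure (received t) (sector_event M l)"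
    by (simp add: measure_def)
  moreover have "psk_signal M (snr * N0) 0 = of_real (r * t)"
    by (simp add: psk_signal_def r_def t_def real_sqrt_mult mult.commute)
  ultimately show ?thesis
    by (simp add: psk_prob_def A_def t_def)
qed

section \<open>Angular regions as half-plane conditions\<close>

text \<open>Off the real axis this is \<open>Arg2pi \<ge> \<phi>\<close>; the description by half-planes is visibly measurable.\<close>

definition arg_ge :: "real \<Rightarrow> (real \<times> real) set" where
  "arg_ge \<phi> = (if \<phi> \<le> pi then {(x, y). y \<le> 0 \<or> x * sin \<phi> \<le> y * cos \<phi>}
    else {(x, y). y \<le> 0 \<and> x * sin \<phi> \<le> y * cos \<phi>})"

lemma measurable_arg_ge [measurable]: "arg_ge \<phi> \<in> sets (borel \<Otimes>\<^sub>M borel)"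
proof -
  have "{(x, y). y \<le> 0 \<or> x * sin \<phi> \<le> y * cos \<phi>} \<in> sets (borel \<Otimes>\<^sub>M borel)"
    "{(x, y). y \<le> 0 \<and> x * sin \<phi> \<le> y * cos \<phi>} \<in> sets (borel \<Otimes>\<^sub>M borel)"
    by (rule sets_Collect_borel_pair, measurable)+
  then show ?thesis by (simp add: arg_ge_def)
qed

text \<open>The edge inequality says \<open>sin (\<phi> - \<theta>) \<le> 0\<close>, which compares
  the angles only if they differ by less than pi. That is guaranteed where \<open>arg_ge\<close>
  relies on it; in the other combinations the sign of y already places the two angles on different
  sides of pi.\<close>

lemma arg_ge_iff:
  assumes "y \<noteq> 0" "0 < \<phi>" "\<phi> < 2 * pi"
  shows "(x, y) \<in> arg_ge \<phi> \<longleftrightarrow> \<phi> \<le> Arg2pi (Complex x y)"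
proof -
  define \<rho> where "\<rho> = cmod (Complex x y)"
  define \<theta> where "\<theta> = Arg2pi (Complex x y)"
  have \<rho>: "0 < \<rho>" using assms(1) by (simp add: \<rho>_def complex_eq_iff)
  have xy: "x = \<rho> * cos \<theta>" "y = \<rho> * sin \<theta>"
    using cos_Arg2pi[of "Complex x y"] sin_Arg2pi[of "Complex x y"] by (simp_all add: \<rho>_def \<theta>_def)
  have \<theta>: "0 \<le> \<theta>" "\<theta> < 2 * pi" by (simp_all add: \<theta>_def Arg2pi_ge_0 Arg2pi_lt_2pi)
  have upper: "0 < \<theta> \<and> \<theta> < pi \<longleftrightarrow> 0 < y"
    using Arg2pi_lt_pi[of "Complex x y"] by (simp add: \<theta>_def)
  have lower: "pi < \<theta>" if "y < 0"
  proof -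
    have "\<theta> \<noteq> 0" "\<theta> \<noteq> pi" using xy(2) assms(1) by auto
    then show ?thesis using upper that \<theta> by auto
  qed
  have "x * sin \<phi> \<le> y * cos \<phi> \<longleftrightarrow> \<rho> * sin (\<phi> - \<theta>) \<le> 0"
    by (simp add: xy sin_diff algebra_simps)
  also have "\<dots> \<longleftrightarrow> sin (\<phi> - \<theta>) \<le> 0" using \<rho> by (simp add: mult_le_0_iff)
  finally have edge: "x * sin \<phi> \<le> y * cos \<phi> \<longleftrightarrow> sin (\<phi> - \<theta>) \<le> 0" .
  have sin: "sin u \<le> 0 \<longleftrightarrow> u \<le> 0" if "- pi < u" "u < pi" for u
    using that sin_gt_zero[of u] sin_ge_zero[of "- u"] by (cases "u \<le> 0") auto
  show ?thesis
  proof (cases "0 < y")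
    case True
    then show ?thesis
      using upper assms sin[of "\<phi> - \<theta>"] by (auto simp: arg_ge_def edge simp flip: \<theta>_def)
  next
    case False
    then have "pi < \<theta>" using lower assms(1) by simp
    then show ?thesis
      using False \<theta> assms sin[of "\<phi> - \<theta>"] by (auto simp: arg_ge_def edge simp flip: \<theta>_def)
  qed
qed

text \<open>Below pi the region is the lower half-plane, of constant probability 1/2, together with
  an upper wedge. At pi the edge is parallel to the shift and has no flux. Above pi the region is
  the reflection of an upper wedge, with t reversed.\<close>

lemma has_derivative_measure_arg_ge:
  assumes "0 < \<phi>" "\<phi> < 2 * pi"
  shows "((\<lambda>t. measure (received t) (arg_ge \<phi>)) has_real_derivative - ray_flux \<phi> t) (at t)"
    and "measure (received 0) (arg_ge \<phi>) = 1 - \<phi> / (2 * pi)"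
proof -
  have lower [measurable]: "{(x, y). y \<le> 0} \<in> sets (borel \<Otimes>\<^sub>M borel :: (real \<times> real) measure)"
    by (rule sets_Collect_borel_pair) measurable
  consider "\<phi> < pi" | "\<phi> = pi" | "pi < \<phi>" by linarith
  then have "((\<lambda>t. measure (received t) (arg_ge \<phi>)) has_real_derivative - ray_flux \<phi> t) (at t) \<and>
    measure (received 0) (arg_ge \<phi>) = 1 - \<phi> / (2 * pi)"
  proof cases
    case 1
    have "measure (received t) (arg_ge \<phi>) = measure (received t) {(x, y). y \<le> 0} + measure (received t) (upper_wedge \<phi>)" for t
      using 1 by (intro measure_received_partition measurable_arg_ge lower measurable_upper_wedge) (auto simp: arg_ge_def upper_wedge_def)
    then have eq: "measure (received t) (arg_ge \<phi>) = 1 / 2 + measure (received t) (upper_wedge \<phi>)" for t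
      unfolding measure_received_lower_half .
    show ?thesis
      unfolding eq using 1 assms
      by (auto simp: measure_upper_wedge_0 field_simps
          intro!: derivative_eq_intros has_derivative_measure_upper_wedge)
  next
    case 2
    then have "arg_ge \<phi> = {(x, y). y \<le> 0}" by (auto simp: arg_ge_def)
    then show ?thesis
      using 2 by (simp add: measure_received_lower_half ray_flux_def)
  next
    case 3
    have "arg_ge \<phi> = {(x, y). (- x, - y) \<in> upper_wedge (\<phi> - pi)}"
      using 3 by (auto simp: arg_ge_def upper_wedge_def)
    then have eq: "measure (received t) (arg_ge \<phi>) = measure (received (- t)) (upper_wedge (\<phi> - pi))" for t
      by (simp add: measure_received_uminus)
    have "((\<lambda>t. measure (received (- t)) (upper_wedge (\<phi> - pi))) has_real_derivative
      - ray_flux (\<phi> - pi) (- t) * - 1) (at t)"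
      using 3 assms
      by (intro DERIV_chain2[where g = uminus and f = "\<lambda>t. measure (received t) (upper_wedge (\<phi> - pi))"]
          has_derivative_measure_upper_wedge) (auto intro!: derivative_eq_intros)
    then show ?thesis
      using 3 assms by (simp add: eq ray_flux_minus_pi measure_upper_wedge_0 field_simps)
  qed
  then show "((\<lambda>t. measure (received t) (arg_ge \<phi>)) has_real_derivative - ray_flux \<phi> t) (at t)"
    "measure (received 0) (arg_ge \<phi>) = 1 - \<phi> / (2 * pi)" by auto
qed

section \<open>Decision sectors in terms of the argument\<close>

lemma Arg2pi_rcis: "0 < \<rho> \<Longrightarrow> 0 \<le> \<theta> \<Longrightarrow> \<theta> < 2 * pi \<Longrightarrow> Arg2pi (of_real \<rho> * cis \<theta>) = \<theta>"
  by (rule Arg2pi_unique) (auto simp: cis_conv_exp)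

text \<open>For 0 < l < M the interval of angles lies within the range [0, 2 pi) of
  \<open>Arg2pi\<close>, so there is no wrap-around.\<close>

lemma decision_region_Arg2pi:
  assumes "Im z \<noteq> 0" "l < M" "0 < l"
  shows "z \<in> decision_region M l \<longleftrightarrow>
    (2 * real l - 1) * pi / real M \<le> Arg2pi z \<and> Arg2pi z < (2 * real l + 1) * pi / real M"
proof
  assume "z \<in> decision_region M l"
  then obtain \<rho> \<theta> where z: "z = of_real \<rho> * cis \<theta>" "0 \<le> \<rho>"
    "(2 * real l - 1) * pi / real M \<le> \<theta>" "\<theta> < (2 * real l + 1) * pi / real M"
    by (auto simp: decision_region_def)
  have "0 < \<rho>" using z assms(1) by (cases "\<rho> = 0") auto
  moreover have "0 \<le> (2 * real l - 1) * pi / real M"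
    using assms by auto
  moreover have "(2 * real l + 1) * pi / real M < 2 * pi"
    using assms mult_strict_right_mono[of "2 * real l + 1" "2 * real M" pi] by (simp add: field_simps)
  ultimately show "(2 * real l - 1) * pi / real M \<le> Arg2pi z \<and> Arg2pi z < (2 * real l + 1) * pi / real M"
    using z Arg2pi_rcis[of \<rho> \<theta>] by simp
next
  assume "(2 * real l - 1) * pi / real M \<le> Arg2pi z \<and> Arg2pi z < (2 * real l + 1) * pi / real M"
  moreover have "z = of_real (cmod z) * cis (Arg2pi z)"
    using Arg2pi_eq[of z] by (simp add: cis_conv_exp)
  ultimately show "z \<in> decision_region M l"
    unfolding decision_region_def by (intro CollectI exI[of _ "cmod z"] exI[of _ "Arg2pi z"]) auto
qed

text \<open>Sector 0 straddles the positive real axis, where \<open>Arg2pi\<close> jumps; its half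
  below the axis appears after a turn by 2 pi.\<close>

lemma decision_region_0_Arg2pi:
  assumes "Im z \<noteq> 0" "2 \<le> M"
  shows "z \<in> decision_region M 0 \<longleftrightarrow> Arg2pi z < pi / real M \<or> 2 * pi - pi / real M \<le> Arg2pi z"
proof
  assume "z \<in> decision_region M 0"
  then obtain \<rho> \<theta> where z: "z = of_real \<rho> * cis \<theta>" "0 \<le> \<rho>" "- pi / real M \<le> \<theta>" "\<theta> < pi / real M"
    by (auto simp: decision_region_def)
  have "0 < \<rho>" using z assms(1) by (cases "\<rho> = 0") auto
  moreover have "pi / real M < 2 * pi" using assms by (simp add: field_simps)
  moreover have "of_real \<rho> * cis \<theta> = of_real \<rho> * cis (\<theta> + 2 * pi)"
    by (simp flip: cis_mult)
  ultimately show "Arg2pi z < pi / real M \<or> 2 * pi - pi / real M \<le> Arg2pi z"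
    using z Arg2pi_rcis[of \<rho> \<theta>] Arg2pi_rcis[of \<rho> "\<theta> + 2 * pi"] by (cases "0 \<le> \<theta>") auto
next
  assume *: "Arg2pi z < pi / real M \<or> 2 * pi - pi / real M \<le> Arg2pi z"
  have z: "z = of_real (cmod z) * cis (Arg2pi z)"
    using Arg2pi_eq[of z] by (simp add: cis_conv_exp)
  also have "\<dots> = of_real (cmod z) * cis (Arg2pi z - 2 * pi)"
    by (simp add: cis_divide[symmetric])
  finally have z': "z = of_real (cmod z) * cis (Arg2pi z - 2 * pi)" .
  have "- (pi / real M) \<le> 0" "0 < pi / real M" using assms by auto
  then obtain \<theta> where "z = of_real (cmod z) * cis \<theta> \<and> - (pi / real M) \<le> \<theta> \<and> \<theta> < pi / real M"
    using * z z' Arg2pi_ge_0[of z] Arg2pi_lt_2pi[of z]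
    by (elim disjE; intro that[of "if Arg2pi z < pi / real M then Arg2pi z else Arg2pi z - 2 * pi"]) auto
  then show "z \<in> decision_region M 0"
    unfolding decision_region_def by (intro CollectI exI[of _ "cmod z"] exI[of _ \<theta>]) auto
qed

lemma measure_sector_event:
  assumes "l < M" "0 < l"
  shows "measure (received t) (sector_event M l)
    = measure (received t) (arg_ge ((2 * real l - 1) * pi / real M))
      - measure (received t) (arg_ge ((2 * real l + 1) * pi / real M))"
proof -
  let ?a = "(2 * real l - 1) * pi / real M" and ?b = "(2 * real l + 1) * pi / real M"
  have "0 < ?a" "?a < ?b" using assms by (auto simp: field_simps)
  moreover have "?b < 2 * pi"
    using assms mult_strict_right_mono[of "2 * real l + 1" "2 * real M" pi] by (simp add: field_simps)
  ultimately have ab: "0 < ?a" "?a < ?b" "?b < 2 * pi" .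
  have "measure (received t) (arg_ge ?a) = measure (received t) (sector_event M l) + measure (received t) (arg_ge ?b)"
    using ab by (intro measure_received_partition measurable_sector_event measurable_arg_ge)
      (auto simp: sector_event_def decision_region_Arg2pi[OF _ assms] arg_ge_iff)
  then show ?thesis by simp
qed

text \<open>Taken through the complement, which, unlike the sector, is a single interval of
  arguments.\<close>

lemma measure_sector_event_0:
  assumes "2 \<le> M"
  shows "measure (received t) (sector_event M 0)
    = 1 - measure (received t) (arg_ge (pi / real M)) + measure (received t) (arg_ge (2 * pi - pi / real M))"
proof -
  interpret prob_space "received t" by (rule prob_space_received)
  let ?a = "pi / real M" and ?b = "2 * pi - pi / real M"
  have "0 < ?a" "?a < pi" using assms by (auto simp: field_simps)
  then have ab: "0 < ?a" "?a < ?b" "?b < 2 * pi" by auto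
  define S where "S = arg_ge ?a - arg_ge ?b"
  have UNIV: "UNIV \<in> sets (borel \<Otimes>\<^sub>M borel :: (real \<times> real) measure)"
    using sets_Collect_borel_pair[of "\<lambda>_. True"] by simp
  have [measurable]: "S \<in> sets (borel \<Otimes>\<^sub>M borel)" unfolding S_def by measurable
  have "measure (received t) (arg_ge ?a) = measure (received t) S + measure (received t) (arg_ge ?b)"
    using ab by (intro measure_received_partition) (auto simp: S_def arg_ge_iff)
  moreover have "measure (received t) UNIV = measure (received t) (sector_event M 0) + measure (received t) S"
    using ab by (intro measure_received_partition UNIV measurable_sector_event \<open>S \<in> _\<close>)
      (auto simp: S_def sector_event_def decision_region_0_Arg2pi[OF _ assms] arg_ge_iff)
  moreover have "measure (received t) UNIV = 1" using prob_space by simp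
  ultimately show ?thesis by linarith
qed

lemma ray_flux_minus_2pi: "ray_flux (2 * pi - \<phi>) t = ray_flux (- \<phi>) t"
  by (simp add: ray_flux_def sin_diff cos_diff)

text \<open>For l = 0 periodicity turns the edge at \<open>2 * pi - pi / M\<close> into the one at
  \<open>- pi / M\<close>, which makes the formula uniform in l.\<close>

lemma has_derivative_sector_prob:
  assumes "l < M" "2 \<le> M"
  shows "((\<lambda>t. measure (received t) (sector_event M l)) has_real_derivative
    ray_flux ((2 * real l + 1) * pi / real M) t - ray_flux ((2 * real l - 1) * pi / real M) t) (at t)"
    and "measure (received 0) (sector_event M l) = 1 / real M"
proof -
  let ?a = "(2 * real l - 1) * pi / real M" and ?b = "(2 * real l + 1) * pi / real M"
  have "((\<lambda>t. measure (received t) (sector_event M l)) has_real_derivative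
    ray_flux ?b t - ray_flux ?a t) (at t) \<and> measure (received 0) (sector_event M l) = 1 / real M"
  proof (cases "l = 0")
    case True
    have "0 < pi / real M" "pi / real M < pi" using assms by (auto simp: field_simps)
    then have "0 < pi / real M" "pi / real M < 2 * pi" "0 < 2 * pi - pi / real M" "2 * pi - pi / real M < 2 * pi"
      by auto
    then show ?thesis
      using True assms ray_flux_minus_2pi[of "pi / real M" t]
      by (auto simp: measure_sector_event_0 has_derivative_measure_arg_ge(2) field_simps
          intro!: derivative_eq_intros has_derivative_measure_arg_ge(1))
  next
    case False
    have "0 < ?a" "?a < ?b" using assms False by (auto simp: field_simps)
    moreover have "?b < 2 * pi"
      using assms mult_strict_right_mono[of "2 * real l + 1" "2 * real M" pi] by (simp add: field_simps)
    ultimately have ab: "0 < ?a" "?a < ?b" "?b < 2 * pi" .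
    then have "0 < ?b" "?a < 2 * pi" by linarith+
    note ab = ab this
    have eq: "measure (received t) (sector_event M l)
      = measure (received t) (arg_ge ?a) - measure (received t) (arg_ge ?b)" for t
      using False assms by (intro measure_sector_event) auto
    have "((\<lambda>t. measure (received t) (sector_event M l)) has_real_derivative
      - ray_flux ?a t - - ray_flux ?b t) (at t)"
      unfolding eq by (intro DERIV_diff has_derivative_measure_arg_ge(1) ab)
    moreover have "measure (received 0) (sector_event M l) = 1 / real M"
      unfolding eq has_derivative_measure_arg_ge(2)[OF ab(1) ab(5)] has_derivative_measure_arg_ge(2)[OF ab(4) ab(3)]
      using assms by (simp add: field_simps)
    ultimately show ?thesis by simp
  qed
  then show "((\<lambda>t. measure (received t) (sector_event M l)) has_real_derivative
    ray_flux ?b t - ray_flux ?a t) (at t)" "measure (received 0) (sector_event M l) = 1 / real M" by auto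
qed

lemma sector_prob_pos:
  assumes "l < M" "2 \<le> M"
  shows "0 < measure (received t) (sector_event M l)"
  using has_derivative_sector_prob(2)[OF assms] measure_received_eq_0[OF measurable_sector_event, of t M l 0] assms
  by (auto simp: zero_less_measure_iff)

section \<open>Capacity\<close>

lemma sector_edges:
  "(2 * real l + 1) * pi / real M = 2 * pi * real l / real M + pi / real M"
  "(2 * real l - 1) * pi / real M = 2 * pi * real l / real M - pi / real M"
  by (simp_all add: add_divide_distrib diff_divide_distrib algebra_simps)

context
  fixes M :: nat
  assumes M: "2 \<le> M"
begin

abbreviation sector_prob :: "nat \<Rightarrow> real \<Rightarrow> real" where
  "sector_prob l t \<equiv> measure (received t) (sector_event M l)"

abbreviation sector_flux :: "nat \<Rightarrow> real \<Rightarrow> real" where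
  "sector_flux l t \<equiv> ray_flux ((2 * real l + 1) * pi / real M) t - ray_flux ((2 * real l - 1) * pi / real M) t"

definition neg_entropy :: "real \<Rightarrow> real" where
  "neg_entropy t = (\<Sum>l<M. sector_prob l t * ln (sector_prob l t))"

text \<open>The factor M in the logarithm, and the absence of the term 1 from the product rule, both
  rest on the vanishing sum of the fluxes. Each logarithm is then 0 at t = 0, as
  \<open>mult_ln_expansion\<close> requires.\<close>

definition neg_entropy_deriv :: "real \<Rightarrow> real" where
  "neg_entropy_deriv t = (\<Sum>l<M. sector_flux l t * ln (real M * sector_prob l t))"

text \<open>What leaves one sector enters its neighbour: the sum telescopes around the circle, and
  periodicity closes it.\<close>

lemma sum_sector_flux: "(\<Sum>l<M. sector_flux l t) = 0"
proof -
  let ?r = "\<lambda>l. ray_flux ((2 * real l - 1) * pi / real M) t"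
  have "(\<Sum>l<M. sector_flux l t) = (\<Sum>l<M. ?r (Suc l) - ?r l)"
    by (intro sum.cong) (auto simp: algebra_simps)
  also have "\<dots> = ?r M - ?r 0" by (rule sum_lessThan_telescope)
  also have "(2 * real M - 1) * pi / real M = 2 * pi - pi / real M"
    using M by (simp add: field_simps)
  finally show ?thesis by (simp add: ray_flux_minus_2pi)
qed

lemma has_derivative_neg_entropy: "(neg_entropy has_real_derivative neg_entropy_deriv t) (at t)"
proof -
  have "(neg_entropy has_real_derivative
      (\<Sum>l<M. sector_flux l t * ln (sector_prob l t) + sector_flux l t / sector_prob l t * sector_prob l t)) (at t)"
    unfolding neg_entropy_def
  proof (rule DERIV_sum)
    fix l assume "l \<in> {..<M}"
    then have l: "l < M" by simp
    note deriv = has_derivative_sector_prob(1)[OF l M, of t]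
    note pos = sector_prob_pos[OF l M, of t]
    show "((\<lambda>t. sector_prob l t * ln (sector_prob l t)) has_real_derivative
      sector_flux l t * ln (sector_prob l t) + sector_flux l t / sector_prob l t * sector_prob l t) (at t)"
      by (rule DERIV_cong[OF DERIV_mult[OF deriv DERIV_chain2[OF DERIV_ln_divide[OF pos] deriv]]]) simp
  qed
  also have "(\<Sum>l<M. sector_flux l t * ln (sector_prob l t) + sector_flux l t / sector_prob l t * sector_prob l t)
    = (\<Sum>l<M. sector_flux l t * ln (real M * sector_prob l t)) + (1 - ln (real M)) * (\<Sum>l<M. sector_flux l t)"
    unfolding sum_distrib_left sum.distrib[symmetric]
  proof (intro sum.cong refl)
    fix l assume "l \<in> {..<M}"
    then have pos: "0 < sector_prob l t" using M by (intro sector_prob_pos) auto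
    have "a * ln p + a / p * p = a * ln (real M * p) + (1 - ln (real M)) * a" if "0 < p" for a p
      using that M by (simp add: ln_mult algebra_simps)
    from this[OF pos] show "sector_flux l t * ln (sector_prob l t) + sector_flux l t / sector_prob l t * sector_prob l t
      = sector_flux l t * ln (real M * sector_prob l t) + (1 - ln (real M)) * sector_flux l t" .
  qed
  finally show ?thesis by (simp add: neg_entropy_deriv_def sum_sector_flux)
qed

definition expansion_coeff1 :: real where
  "expansion_coeff1 = (if M = 2 then 4 / pi else (real M)\<^sup>2 * (sin (pi / M))\<^sup>2 / (2 * pi))"

text \<open>For M = 3 the first term comes from the sum of \<open>cos x * cos (2 * x)\<close> and
  the second from the sum of \<open>cos x ^ 3\<close>, with the sines of 60 and 120 degrees
  inserted.\<close>

definition expansion_coeff2 :: real where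
  "expansion_coeff2 = (if M = 3 then 81 / (16 * pi * sqrt pi) - 81 * sqrt 3 / (64 * pi * sqrt pi) else 0)"

definition expansion_coeff3 :: real where
  "expansion_coeff3 = (\<Sum>l<M. let x = 2 * pi * real l / real M in
     - (M / (3 * pi)) * (3 * (sin (pi / M))\<^sup>2 * (cos x)\<^sup>2 - sin (pi / M) * sin (3 * (pi / M)) * (cos x * cos (3 * x)))
     + M * (sin (2 * (pi / M)))\<^sup>2 / (2 * pi\<^sup>2) * (cos (2 * x))\<^sup>2
     - (real M)\<^sup>2 * (sin (pi / M))\<^sup>2 * sin (2 * (pi / M)) / pi\<^sup>2 * ((cos x)\<^sup>2 * cos (2 * x))
     + (real M) ^ 3 * sin (pi / M) ^ 4 / (3 * pi\<^sup>2) * cos x ^ 4)"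

lemma neg_entropy_deriv_expansion:
  "((\<lambda>t. (neg_entropy_deriv t - expansion_coeff1 * t - expansion_coeff2 * t\<^sup>2) / t ^ 3)
    \<longlongrightarrow> expansion_coeff3) (at_right 0)"
proof -
  define d where "d = pi / real M"
  define x where "x l = 2 * pi * real l / real M" for l
  \<comment> \<open>The Taylor coefficients a, b, c of the probability of sector l at t = 0,
    obtained from the flux and its first two derivatives at the edge angles \<open>x l + d\<close>
    and \<open>x l - d\<close>.\<close>
  define a where "a l = sin d * cos (x l) / sqrt pi" for l
  define b where "b l = sin (2 * d) * cos (2 * x l) / (2 * pi)" for l
  define c where "c l = - (3 * sin d * cos (x l) - sin (3 * d) * cos (3 * x l)) / (12 * sqrt pi)" for l
  define m where "m = real M"
  have m: "0 < m" using M by (simp add: m_def)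
  have sq: "sqrt pi ^ 2 = pi" "sqrt pi ^ 3 = pi * sqrt pi" "sqrt pi ^ 4 = pi\<^sup>2"
    by (simp_all add: power3_eq_cube power4_eq_xxxx power2_eq_square)
  note edges = sector_edges[of _ M, folded d_def x_def]
  note moments = psk_moment_sums[OF M, folded x_def]
  have "((\<lambda>t. (sector_flux l t * ln (m * sector_prob l t) - m * (a l)\<^sup>2 * t
      - (3 * m * a l * b l - m\<^sup>2 * a l ^ 3 / 2) * t\<^sup>2) / t ^ 3)
    \<longlongrightarrow> 4 * m * a l * c l + 2 * m * (b l)\<^sup>2 - 2 * m\<^sup>2 * (a l)\<^sup>2 * b l + m ^ 3 * a l ^ 4 / 3) (at_right 0)"
    if l: "l < M" for l
  proof (rule mult_ln_expansion)
    let ?f1 = "\<lambda>t. ray_flux_deriv ((2 * real l + 1) * pi / real M) t - ray_flux_deriv ((2 * real l - 1) * pi / real M) t"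
    show "((\<lambda>t. sector_prob l t) has_real_derivative sector_flux l t) (at t)" for t
      by (rule has_derivative_sector_prob[OF l M])
    show "((\<lambda>t. sector_flux l t) has_real_derivative ?f1 t) (at t)" for t
      by (intro DERIV_diff has_derivative_ray_flux)
    have "(?f1 has_real_derivative - (sin (x l + d) ^ 3 / sqrt pi) - - (sin (x l - d) ^ 3 / sqrt pi)) (at 0)"
      unfolding edges by (intro DERIV_diff has_derivative_ray_flux_deriv_0)
    also have "- (sin (x l + d) ^ 3 / sqrt pi) - - (sin (x l - d) ^ 3 / sqrt pi)
      = - (sin (x l + d) ^ 3 - sin (x l - d) ^ 3) / sqrt pi"
      by (simp add: field_simps)
    also have "\<dots> = 6 * c l" unfolding sin_cubed_diff c_def by (simp add: field_simps)
    finally show "(?f1 has_real_derivative 6 * c l) (at 0)" .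
    show "sector_prob l 0 = 1 / m"
      using has_derivative_sector_prob(2)[OF l M] by (simp add: m_def)
    show "sector_flux l 0 = a l"
      unfolding edges by (simp add: ray_flux_0 a_def sin_add sin_diff field_simps)
    have "sin (x l + d) * cos (x l + d) - sin (x l - d) * cos (x l - d)
      = (sin (2 * (x l + d)) - sin (2 * (x l - d))) / 2"
      unfolding sin_double by simp
    also have "\<dots> = sin (2 * d) * cos (2 * x l)"
      by (simp add: sin_add sin_diff algebra_simps)
    finally show "?f1 0 = 2 * b l"
      unfolding edges by (simp add: ray_flux_deriv_0 b_def flip: diff_divide_distrib)
  qed fact
  then have "((\<lambda>t. \<Sum>l<M. (sector_flux l t * ln (m * sector_prob l t) - m * (a l)\<^sup>2 * t
      - (3 * m * a l * b l - m\<^sup>2 * a l ^ 3 / 2) * t\<^sup>2) / t ^ 3)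
    \<longlongrightarrow> (\<Sum>l<M. 4 * m * a l * c l + 2 * m * (b l)\<^sup>2 - 2 * m\<^sup>2 * (a l)\<^sup>2 * b l + m ^ 3 * a l ^ 4 / 3)) (at_right 0)"
    by (intro tendsto_sum) auto
  moreover have "(\<Sum>l<M. 4 * m * a l * c l + 2 * m * (b l)\<^sup>2 - 2 * m\<^sup>2 * (a l)\<^sup>2 * b l + m ^ 3 * a l ^ 4 / 3)
    = expansion_coeff3"
    unfolding expansion_coeff3_def Let_def a_def b_def c_def d_def[symmetric] x_def[symmetric]
    unfolding m_def[symmetric]
    by (intro sum.cong refl) (simp add: power_mult_distrib power_divide sq, simp add: field_simps power2_eq_square)
  moreover have "(\<Sum>l<M. m * (a l)\<^sup>2) = expansion_coeff1"
  proof -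
    have "(\<Sum>l<M. m * (a l)\<^sup>2) = m * (sin d)\<^sup>2 / pi * (\<Sum>l<M. (cos (x l))\<^sup>2)"
      by (simp add: a_def sum_distrib_left power_mult_distrib power_divide sq mult.assoc)
    then show ?thesis
      unfolding moments by (simp add: expansion_coeff1_def d_def m_def power2_eq_square)
  qed
  moreover have "(\<Sum>l<M. 3 * m * a l * b l - m\<^sup>2 * a l ^ 3 / 2) = expansion_coeff2"
  proof -
    have "(\<Sum>l<M. 3 * m * a l * b l - m\<^sup>2 * a l ^ 3 / 2)
      = 3 * m * sin d * sin (2 * d) / (2 * pi * sqrt pi) * (\<Sum>l<M. cos (x l) * cos (2 * x l))
       - m\<^sup>2 * sin d ^ 3 / (2 * pi * sqrt pi) * (\<Sum>l<M. cos (x l) ^ 3)"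
      unfolding sum_distrib_left sum_subtractf[symmetric]
      by (intro sum.cong refl) (simp add: a_def b_def power_mult_distrib power_divide sq mult_ac)
    then show ?thesis
      unfolding moments
      by (auto simp: expansion_coeff2_def d_def m_def sin_60 sin_120 power3_eq_cube)
  qed
  ultimately show ?thesis
    by (simp add: neg_entropy_deriv_def m_def sum_subtractf flip: sum_divide_distrib sum_distrib_right)
qed

lemma expansion_coeff2_pos: "M = 3 \<Longrightarrow> 0 < expansion_coeff2"
proof -
  assume "M = 3"
  have "sqrt 3 < 4" by (rule real_less_lsqrt) auto
  then show ?thesis
    unfolding expansion_coeff2_def using \<open>M = 3\<close> by (simp add: field_simps)
qed

text \<open>The second derivative of the capacity is half of this coefficient, so
  \<open>psk_psi M\<close> is that derivative for M \<ge> 5. The values for M = 2 and M = 4 differ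
  because the fourth harmonic does not cancel there.\<close>

lemma expansion_coeff3_eq:
  assumes "M \<noteq> 3"
  shows "expansion_coeff3 = (if M = 2 then - 16 * (pi - 1) / (3 * pi\<^sup>2)
    else if M = 4 then - 8 * (pi - 1) / (3 * pi\<^sup>2) else 2 * psk_psi M)"
proof -
  define d where "d = pi / real M"
  define m where "m = real M"
  have "expansion_coeff3 =
     - (m / (3 * pi)) * (3 * (sin d)\<^sup>2 * (if M = 2 then 2 else m / 2)
         - sin d * sin (3 * d) * (if M = 2 then 2 else if M = 4 then 2 else 0))
     + m * (sin (2 * d))\<^sup>2 / (2 * pi\<^sup>2) * (if M = 2 then 2 else if M = 4 then 4 else m / 2)
     - m\<^sup>2 * (sin d)\<^sup>2 * sin (2 * d) / pi\<^sup>2 * (if M = 2 then 2 else if M = 4 then 2 else m / 4)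
     + m ^ 3 * sin d ^ 4 / (3 * pi\<^sup>2) * (if M = 2 then 2 else if M = 4 then 2 else 3 * m / 8)"
    unfolding m_def d_def
    by (simp only: expansion_coeff3_def Let_def sum.distrib sum_subtractf
        sum_distrib_left[symmetric] psk_moment_sums[OF M])
  note eq = this
  consider "M = 2" | "M = 4" | "M \<noteq> 2" "M \<noteq> 4" by blast
  then show ?thesis
  proof cases
    case 1
    have s: "sin (3 * d) = - 1" "sin (2 * d) = 0" "sin d = 1"
      using 1 sin_3[of d] by (simp_all add: d_def)
    show ?thesis
      unfolding eq s using 1 by (simp add: m_def field_simps power2_eq_square)
  next
    case 2
    have s: "sin d = sqrt 2 / 2" "sin (2 * d) = 1"
      using 2 by (simp_all add: d_def sin_45)
    have s3: "sin (3 * d) = sqrt 2 / 2"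
      unfolding sin_3 s by (simp add: power3_eq_cube)
    show ?thesis
      unfolding eq s s3 using 2 by (simp add: m_def field_simps power2_eq_square power4_eq_xxxx)
  next
    case 3
    \<comment> \<open>With this relation the terms of \<open>psk_psi\<close> containing pi collapse
      to a single multiple of \<open>(sin d)\<^sup>2\<close>, the form in which the moment sums
      produce them.\<close>
    have double: "(sin (2 * d))\<^sup>2 = 4 * (sin d)\<^sup>2 * (1 - (sin d)\<^sup>2)"
      unfolding sin_double by (simp add: power_mult_distrib cos_squared_eq)
    have "psk_psi M = m\<^sup>2 / (16 * pi\<^sup>2) *
      ((2 - pi) * (sin (2 * d))\<^sup>2 + (m\<^sup>2 - 4 * pi) * sin d ^ 4 - 2 * m * (sin d)\<^sup>2 * sin (2 * d))"
      by (simp add: psk_psi_def m_def d_def)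
    also have "(2 - pi) * (sin (2 * d))\<^sup>2 + (m\<^sup>2 - 4 * pi) * sin d ^ 4 - 2 * m * (sin d)\<^sup>2 * sin (2 * d)
      = 2 * (sin (2 * d))\<^sup>2 - 4 * pi * (sin d)\<^sup>2 + m\<^sup>2 * sin d ^ 4 - 2 * m * (sin d)\<^sup>2 * sin (2 * d)"
      using double by algebra
    finally have psi: "2 * psk_psi M = m\<^sup>2 / (8 * pi\<^sup>2) *
      (2 * (sin (2 * d))\<^sup>2 - 4 * pi * (sin d)\<^sup>2 + m\<^sup>2 * sin d ^ 4 - 2 * m * (sin d)\<^sup>2 * sin (2 * d))"
      by simp
    show ?thesis
      unfolding eq psi using 3 by (simp add: field_simps power2_eq_square power3_eq_cube power4_eq_xxxx)
  qed
qed

lemma neg_entropy_0: "neg_entropy 0 = - ln (real M)"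
  using M by (simp add: neg_entropy_def has_derivative_sector_prob(2) ln_div)

text \<open>Integrates the leading term of the expansion. Since t^2 is the SNR, this is the capacity
  per unit of SNR.\<close>

lemma neg_entropy_increment:
  "((\<lambda>t. (neg_entropy t + ln (real M)) / t\<^sup>2) \<longlongrightarrow> expansion_coeff1 / 2) (at_right 0)"
proof -
  define R where "R t = (neg_entropy_deriv t - expansion_coeff1 * t - expansion_coeff2 * t\<^sup>2) / t ^ 3" for t
  have "((\<lambda>t. expansion_coeff1 + expansion_coeff2 * t + t\<^sup>2 * R t)
      \<longlongrightarrow> expansion_coeff1 + expansion_coeff2 * 0 + 0\<^sup>2 * expansion_coeff3) (at_right 0)"
    unfolding R_def by (intro tendsto_intros neg_entropy_deriv_expansion)
  then have "((\<lambda>t. expansion_coeff1 + expansion_coeff2 * t + t\<^sup>2 * R t) \<longlongrightarrow> expansion_coeff1) (at_right 0)"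
    by simp
  then have "((\<lambda>t. neg_entropy_deriv t / t ^ 1) \<longlongrightarrow> expansion_coeff1) (at_right 0)"
    by (rule Lim_transform_eventually)
       (auto simp: R_def field_simps power2_eq_square power3_eq_cube intro!: eventually_at_rightI[of 0 1])
  moreover have "((\<lambda>t. neg_entropy t + ln (real M)) \<longlongrightarrow> 0) (at_right 0)"
  proof -
    have "(neg_entropy \<longlongrightarrow> - ln (real M)) (at_right 0)"
      using DERIV_isCont[OF has_derivative_neg_entropy[of 0]]
      by (auto simp: isCont_def neg_entropy_0 intro: tendsto_mono[OF at_le])
    from tendsto_add[OF this tendsto_const[of "ln (real M)"]] show ?thesis by simp
  qed
  ultimately have "((\<lambda>t. (neg_entropy t + ln (real M)) / t ^ Suc 1) \<longlongrightarrow> expansion_coeff1 / Suc 1) (at_right 0)"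
    by (intro tendsto_antideriv_over_power[where k = neg_entropy_deriv])
       (auto intro!: derivative_eq_intros has_derivative_neg_entropy)
  then show ?thesis by (simp add: power2_eq_square)
qed

section \<open>Derivatives with respect to the SNR\<close>

context
  fixes N0 :: real
  assumes N0: "0 < N0"
begin

lemma capacity_eq: "0 \<le> snr \<Longrightarrow> capacity M N0 snr = ln (real M) + neg_entropy (sqrt snr)"
  using N0 by (simp add: capacity_def neg_entropy_def psk_prob_eq_received)

lemma filterlim_sqrt_at_right_0: "filterlim sqrt (at_right 0) (at_right (0::real))"
  unfolding filterlim_at
  by (auto intro!: tendsto_eq_intros eventually_at_rightI[of 0 1])

lemma capacity_over_snr:
  "((\<lambda>snr. capacity M N0 snr / snr) \<longlongrightarrow> expansion_coeff1 / 2) (at_right 0)"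
  using filterlim_compose[OF neg_entropy_increment filterlim_sqrt_at_right_0]
  by (rule Lim_transform_eventually)
     (auto simp: capacity_eq add.commute intro!: eventually_at_rightI[of 0 1])

text \<open>The chain rule fails at 0, where \<open>sqrt\<close> has no derivative, so the
  difference quotient is used directly.\<close>

lemma has_derivative_capacity_0:
  "(capacity M N0 has_real_derivative expansion_coeff1 / 2) (at 0 within {0..})"
  using capacity_over_snr
  by (simp add: has_field_derivative_iff capacity_eq neg_entropy_0 at_within_Ici_at_right)

lemma has_derivative_capacity:
  assumes "0 < snr"
  shows "(capacity M N0 has_real_derivative neg_entropy_deriv (sqrt snr) / (2 * sqrt snr)) (at snr within {0..})"
proof -
  have "((\<lambda>snr. ln (real M) + neg_entropy (sqrt snr)) has_real_derivative
      0 + neg_entropy_deriv (sqrt snr) * (inverse (sqrt snr) / 2)) (at snr within {0..})"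
    using assms
    by (intro DERIV_add DERIV_const DERIV_chain2[OF has_derivative_neg_entropy]
        DERIV_real_sqrt[THEN has_field_derivative_at_within])
  then have "((\<lambda>snr. ln (real M) + neg_entropy (sqrt snr)) has_real_derivative
      neg_entropy_deriv (sqrt snr) / (2 * sqrt snr)) (at snr within {0..})"
    by (simp add: field_simps)
  then show ?thesis
    by (rule has_field_derivative_transform_within[OF _ zero_less_one]) (use assms in \<open>auto simp: capacity_eq\<close>)
qed

lemma capacity_deriv_eq:
  "capacity_deriv M N0 0 = expansion_coeff1 / 2"
  "0 < snr \<Longrightarrow> capacity_deriv M N0 snr = neg_entropy_deriv (sqrt snr) / (2 * sqrt snr)"
proof -
  \<comment> \<open>A vector derivative within a set is unique only at a point that is not isolated
    in it.\<close>
  have "at u within {0..} \<noteq> bot" if "0 \<le> u" for u :: real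
  proof -
    have "at_right u \<le> at u within {0..}" using that by (intro at_le) auto
    then show ?thesis using trivial_limit_at_right_real[of u] by (auto simp: bot_unique)
  qed
  note within = vector_derivative_within[OF this, of _ "capacity M N0",
      folded has_real_derivative_iff_has_vector_derivative, folded capacity_deriv_def]
  show "capacity_deriv M N0 0 = expansion_coeff1 / 2"
    by (rule within[OF _ has_derivative_capacity_0]) simp
  show "0 < snr \<Longrightarrow> capacity_deriv M N0 snr = neg_entropy_deriv (sqrt snr) / (2 * sqrt snr)"
    by (rule within[OF _ has_derivative_capacity]) auto
qed

lemma tendsto_capacity_deriv2_quot:
  "(capacity_deriv2_quot M N0 \<longlongrightarrow> (if M = 3 then \<infinity> else ereal (expansion_coeff3 / 2))) (at_right 0)"
proof -
  define R where "R t = (neg_entropy_deriv t - expansion_coeff1 * t - expansion_coeff2 * t\<^sup>2) / t ^ 3" for t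
  have R: "((\<lambda>snr. R (sqrt snr) / 2) \<longlongrightarrow> expansion_coeff3 / 2) (at_right 0)"
    unfolding R_def
    by (rule tendsto_divide[OF filterlim_compose[OF neg_entropy_deriv_expansion filterlim_sqrt_at_right_0] tendsto_const]) simp
  \<comment> \<open>The t^2 term of the expansion is one order too low for the quotient and becomes
    a multiple of \<open>inverse (sqrt snr)\<close>; its sign decides about the infinite
    limit.\<close>
  have quotient: "(capacity_deriv M N0 snr - capacity_deriv M N0 0) / snr
    = expansion_coeff2 / 2 * inverse (sqrt snr) + R (sqrt snr) / 2" if "0 < snr" for snr
  proof -
    define t where "t = sqrt snr"
    have t: "0 < t" "t\<^sup>2 = snr" using that by (auto simp: t_def)
    have "(h / (2 * t) - k / 2) / t\<^sup>2 = k' / 2 * inverse t + (h - k * t - k' * t\<^sup>2) / t ^ 3 / 2" for h k k'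
      using t(1) by (simp add: field_simps power2_eq_square power3_eq_cube)
    from this[of "neg_entropy_deriv t" expansion_coeff1 expansion_coeff2] show ?thesis
      unfolding capacity_deriv_eq(1) capacity_deriv_eq(2)[OF that] t_def[symmetric] R_def t(2) .
  qed
  have quot: "\<forall>\<^sub>F snr in at_right 0. ereal (expansion_coeff2 / 2 * inverse (sqrt snr) + R (sqrt snr) / 2)
    = capacity_deriv2_quot M N0 snr"
  proof (rule eventually_at_rightI[of 0 1])
    fix snr :: real assume "snr \<in> {0<..<1}"
    then have "0 < snr" by simp
    from quotient[OF this]
    show "ereal (expansion_coeff2 / 2 * inverse (sqrt snr) + R (sqrt snr) / 2) = capacity_deriv2_quot M N0 snr"
      unfolding capacity_deriv2_quot_def by (rule arg_cong[of _ _ ereal, OF sym])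
  qed simp
  show ?thesis
  proof (cases "M = 3")
    case True
    have "filterlim (\<lambda>snr. inverse (sqrt snr)) at_top (at_right 0)"
      by (rule filterlim_compose[OF filterlim_inverse_at_top_right filterlim_sqrt_at_right_0])
    then have "filterlim (\<lambda>snr. expansion_coeff2 / 2 * inverse (sqrt snr)) at_top (at_right 0)"
      using expansion_coeff2_pos[OF True]
      by (intro filterlim_tendsto_pos_mult_at_top[OF tendsto_const]) simp_all
    from filterlim_tendsto_add_at_top[OF R this]
    have "filterlim (\<lambda>snr. expansion_coeff2 / 2 * inverse (sqrt snr) + R (sqrt snr) / 2) at_top (at_right 0)"
      by (simp only: add.commute)
    then have "(capacity_deriv2_quot M N0 \<longlongrightarrow> \<infinity>) (at_right 0)"
      unfolding tendsto_PInfty_eq_at_top[symmetric] by (rule Lim_transform_eventually[OF _ quot])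
    then show ?thesis unfolding if_P[OF True] .
  next
    case False
    then have coeff2: "expansion_coeff2 = 0"
      unfolding expansion_coeff2_def by (rule if_not_P)
    have "((\<lambda>snr. ereal (expansion_coeff2 / 2 * inverse (sqrt snr) + R (sqrt snr) / 2)) \<longlongrightarrow> ereal (expansion_coeff3 / 2)) (at_right 0)"
      unfolding coeff2 using R by (simp only: div_0 mult_zero_left add_0 lim_ereal)
    then have "(capacity_deriv2_quot M N0 \<longlongrightarrow> ereal (expansion_coeff3 / 2)) (at_right 0)"
      by (rule Lim_transform_eventually[OF _ quot])
    then show ?thesis unfolding if_not_P[OF False] .
  qed
qed

lemma capacity_deriv2_zero_eq:
  "capacity_deriv2_zero M N0 = (if M = 3 then \<infinity> else ereal (expansion_coeff3 / 2))"
  unfolding capacity_deriv2_zero_def by (rule tendsto_Lim[OF _ tendsto_capacity_deriv2_quot]) simp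

lemma capacity_differentiable:
  assumes "0 \<le> snr"
  shows "capacity M N0 differentiable (at snr within {0..})"
proof (cases "snr = 0")
  case True
  then show ?thesis
    using differentiableI[OF has_field_derivative_imp_has_derivative[OF has_derivative_capacity_0]] by simp
next
  case False
  with assms have "0 < snr" by simp
  from differentiableI[OF has_field_derivative_imp_has_derivative[OF has_derivative_capacity[OF this]]]
  show ?thesis .
qed

lemma tendsto_bit_energy:
  "(bit_energy M N0 \<longlongrightarrow> bit_energy_zero M N0) (at_right 0)"
proof -
  have "0 < sin (pi / real M)" using M by (intro sin_gt_zero) (auto simp: field_simps)
  then have "expansion_coeff1 / 2 \<noteq> 0" using M by (simp add: expansion_coeff1_def)
  then have "((\<lambda>snr. ln 2 / (capacity M N0 snr / snr)) \<longlongrightarrow> ln 2 / (expansion_coeff1 / 2)) (at_right 0)"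
    by (intro tendsto_divide[OF tendsto_const capacity_over_snr])
  then show ?thesis
    unfolding bit_energy_zero_def capacity_deriv_eq(1)
    by (rule Lim_transform_eventually) (simp add: bit_energy_def capacity_bits_def)
qed

end

end

text \<open>\<open>vector_derivative\<close> and \<open>Lim\<close> denote something even where no
  derivative or limit exists, and \<open>real_of_ereal\<close> sends infinities to 0. The first five
  conjuncts establish that the derivatives and limits are genuine and say which are finite, so that
  the two closed formulas mean what they should.\<close>

theorem corollary2:
  fixes M :: nat and N0 :: real
  assumes "2 \<le> M" and "0 < N0"
  shows
    "(\<forall>snr\<ge>0. capacity M N0 differentiable (at snr within {0..})) \<and>
     (capacity_deriv2_quot M N0 \<longlongrightarrow> capacity_deriv2_zero M N0) (at_right 0) \<and>
     capacity_deriv2_zero M N0 \<noteq> - \<infinity> \<and>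
     (capacity_deriv2_zero M N0 = \<infinity> \<longleftrightarrow> M = 3) \<and>
     (bit_energy M N0 \<longlongrightarrow> bit_energy_zero M N0) (at_right 0) \<and>
     bit_energy_zero M N0 =
       (if M = 2 then pi / 2 * ln 2
        else 4 * pi / ((real M)\<^sup>2 * (sin (pi / real M))\<^sup>2) * ln 2) \<and>
     wideband_slope M N0 =
       (if M = 2 then 3 / (pi - 1)
        else if M = 3 then 0
        else if M = 4 then 6 / (pi - 1)
        else ((real M) ^ 4 / (8 * pi\<^sup>2) * sin (pi / real M) ^ 4) / (- psk_psi M))"
proof (intro conjI)
  note deriv2 = capacity_deriv2_zero_eq[OF assms]
  note deriv = capacity_deriv_eq(1)[OF assms] expansion_coeff1_def[OF assms(1)]
  show "\<forall>snr\<ge>0. capacity M N0 differentiable (at snr within {0..})"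
    using capacity_differentiable[OF assms] by blast
  show "(capacity_deriv2_quot M N0 \<longlongrightarrow> capacity_deriv2_zero M N0) (at_right 0)"
    unfolding deriv2 by (rule tendsto_capacity_deriv2_quot[OF assms])
  show "capacity_deriv2_zero M N0 \<noteq> - \<infinity>" "capacity_deriv2_zero M N0 = \<infinity> \<longleftrightarrow> M = 3"
    unfolding deriv2 by auto
  show "(bit_energy M N0 \<longlongrightarrow> bit_energy_zero M N0) (at_right 0)"
    by (rule tendsto_bit_energy[OF assms])
  show "bit_energy_zero M N0 =
       (if M = 2 then pi / 2 * ln 2
        else 4 * pi / ((real M)\<^sup>2 * (sin (pi / real M))\<^sup>2) * ln 2)"
    unfolding bit_energy_zero_def deriv by simp
  show "wideband_slope M N0 =
       (if M = 2 then 3 / (pi - 1)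
        else if M = 3 then 0
        else if M = 4 then 6 / (pi - 1)
        else ((real M) ^ 4 / (8 * pi\<^sup>2) * sin (pi / real M) ^ 4) / (- psk_psi M))"
  proof (cases "M = 3")
    case True
    then show ?thesis unfolding wideband_slope_def deriv2 by simp
  next
    case False
    have "pi - 1 > 0" using pi_gt3 by simp
    consider "M = 2" | "M = 4" | "M \<noteq> 2" "M \<noteq> 4" by blast
    then show ?thesis
    proof cases
      case 1
      then show ?thesis
        unfolding wideband_slope_def deriv2 deriv expansion_coeff3_eq[OF assms(1) False]
        using \<open>pi - 1 > 0\<close> by (simp add: field_simps power2_eq_square)
    next
      case 2
      have s: "sin (pi / real M) = sqrt 2 / 2" using 2 by (simp add: sin_45)
      show ?thesis
        unfolding wideband_slope_def deriv2 deriv expansion_coeff3_eq[OF assms(1) False] s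
        using 2 \<open>pi - 1 > 0\<close> by (simp add: field_simps power2_eq_square)
    next
      case 3
      then show ?thesis
        unfolding wideband_slope_def deriv2 deriv expansion_coeff3_eq[OF assms(1) False]
        using False by (simp add: power_divide power_mult_distrib flip: power_mult)
    qed
  qed
qed

end
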